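(* Let $F$ be a field of characteristic $0$. (a) If an $F$-algebra $A$ satisfies a polynomial identity of degree $d$, then $A$ satisfies a nontrivial strong identity of degree $d'=\lceil e(d-1)^4\rceil^2$ (with $e=2.71828\ldots$). (b) If moreover $A=F\{a_1,\dots,a_r\}$ is affine and $d'$ is as in (a), then for $n=r^{d'}+d'$, $A$ satisfies the Capelli identity $\mathrm{Cap}_n$. In particular every affine PI algebra over a field of characteristic $0$ satisfies some Capelli identity.
   Context: $V_m$ denotes the space of multilinear polynomials in $x_1,\dots,x_m$, identified with $F[S_m]$ via $\sigma\leftrightarrow x_{\sigma(1)}\cdots x_{\sigma(m)}$. $S_m$ acts on $V_m$ on the left by $\sigma p(x_1,\dots,x_m)=p(x_{\sigma(1)},\dots,x_{\sigma(m)})$ and on the right by place permutations: $(x_{\tau(1)}\cdots x_{\tau(m)})\pi=x_{\tau\pi(1)}\cdots x_{\tau\pi(m)}$ with the convention $\tau\pi(i)=\pi(\tau(i))$. For $n\le m$, $V_n\subseteq V_m$ via $g\mapsto g\,x_{n+1}\cdots x_m$. $\mathrm{Id}(A)$ is the set of polynomial identities of $A$. A nonzero $g\in V_n$ is a strong identity of $A$ if for every $m\ge n$, $F[S_m]\,g\,F[S_m]\subseteq\mathrm{Id}(A)$. $\mathrm{Cap}_n(x_1,\dots,x_n;y_1,\dots,y_n)=\sum_{\pi\in S_n}\operatorname{sgn}(\pi)x_{\pi(1)}y_1\cdots x_{\pi(n)}y_n$. *)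

theory Defs
  imports Complex_Main "HOL-Combinatorics.Permutations"
begin

definition f_algebra :: "('f::field \<Rightarrow> 'b::ring_1 \<Rightarrow> 'b) \<Rightarrow> bool" where
  "f_algebra smul \<longleftrightarrow>
     (\<forall>c x y. smul c (x + y) = smul c x + smul c y) \<and>
     (\<forall>c d x. smul (c + d) x = smul c x + smul d x) \<and>
     (\<forall>c d x. smul (c * d) x = smul c (smul d x)) \<and>
     (\<forall>x. smul 1 x = x) \<and>
     (\<forall>c x y. smul c (x * y) = smul c x * y) \<and>
     (\<forall>c x y. smul c (x * y) = x * smul c y)"

text \<open>Noncommutative polynomials F<x_0, x_1, ...>: finitely supported coefficient
  functions on words (lists of variable indices).\<close>
definition ncpoly :: "(nat list \<Rightarrow> 'f::field) \<Rightarrow> bool" where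
  "ncpoly p \<longleftrightarrow> finite {w. p w \<noteq> 0}"

definition ncdegree :: "(nat list \<Rightarrow> 'f::field) \<Rightarrow> nat" where
  "ncdegree p = Max (length ` {w. p w \<noteq> 0})"

definition peval :: "('f::field \<Rightarrow> 'b::ring_1 \<Rightarrow> 'b) \<Rightarrow> (nat list \<Rightarrow> 'f) \<Rightarrow> (nat \<Rightarrow> 'b) \<Rightarrow> 'b" where
  "peval smul p a = (\<Sum>w\<in>{w. p w \<noteq> 0}. smul (p w) (prod_list (map a w)))"

definition Id_alg :: "('f::field \<Rightarrow> 'b::ring_1 \<Rightarrow> 'b) \<Rightarrow> (nat list \<Rightarrow> 'f) set" where
  "Id_alg smul = {p. ncpoly p \<and> (\<forall>a. peval smul p a = 0)}"

definition has_PI_of_degree :: "('f::field \<Rightarrow> 'b::ring_1 \<Rightarrow> 'b) \<Rightarrow> nat \<Rightarrow> bool" where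
  "has_PI_of_degree smul d \<longleftrightarrow>
     (\<exists>p. p \<in> Id_alg smul \<and> p \<noteq> (\<lambda>_. 0) \<and> ncdegree p = d)"

text \<open>Group algebra F[S_m]: coefficient functions supported on permutations of {1..m}.
  Since permutations of {1..n} are permutations of {1..m} fixing n+1..m, for n \<le> m
  an element of F[S_n] is literally an element of F[S_m]; this is the embedding
  V_n \<subseteq> V_m, g \<mapsto> g x_{n+1}\<dots>x_m.\<close>
definition grp_alg :: "nat \<Rightarrow> ((nat \<Rightarrow> nat) \<Rightarrow> 'f::field) set" where
  "grp_alg m = {c. \<forall>\<tau>. c \<tau> \<noteq> 0 \<longrightarrow> \<tau> permutes {1..m}}"

definition ga_mult :: "nat \<Rightarrow> ((nat \<Rightarrow> nat) \<Rightarrow> 'f::field) \<Rightarrow> ((nat \<Rightarrow> nat) \<Rightarrow> 'f) \<Rightarrow> ((nat \<Rightarrow> nat) \<Rightarrow> 'f)" where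
  "ga_mult m a b = (\<lambda>\<rho>. \<Sum>\<sigma>\<in>{\<sigma>. \<sigma> permutes {1..m}}. a \<sigma> * b (inv \<sigma> \<circ> \<rho>))"

definition poly_of_ga :: "nat \<Rightarrow> ((nat \<Rightarrow> nat) \<Rightarrow> 'f::field) \<Rightarrow> (nat list \<Rightarrow> 'f)" where
  "poly_of_ga m c = (\<lambda>w. \<Sum>\<tau>\<in>{\<tau>. \<tau> permutes {1..m}}.
                           if map \<tau> [1..<Suc m] = w then c \<tau> else 0)"

definition strong_identity ::
  "('f::field \<Rightarrow> 'b::ring_1 \<Rightarrow> 'b) \<Rightarrow> nat \<Rightarrow> ((nat \<Rightarrow> nat) \<Rightarrow> 'f) \<Rightarrow> bool" where
  "strong_identity smul n g \<longleftrightarrow>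
     g \<in> grp_alg n \<and> g \<noteq> (\<lambda>_. 0) \<and>
     (\<forall>m\<ge>n. \<forall>a\<in>grp_alg m. \<forall>b\<in>grp_alg m.
        poly_of_ga m (ga_mult m (ga_mult m a g) b) \<in> Id_alg smul)"

definition affine_gen :: "('f::field \<Rightarrow> 'b::ring_1 \<Rightarrow> 'b) \<Rightarrow> nat \<Rightarrow> (nat \<Rightarrow> 'b) \<Rightarrow> bool" where
  "affine_gen smul r gen \<longleftrightarrow>
     (\<forall>x. \<exists>P c. finite P \<and> (\<forall>w\<in>P. set w \<subseteq> {1..r}) \<and>
              x = (\<Sum>w\<in>P. smul (c w) (prod_list (map gen w))))"

definition satisfies_capelli :: "nat \<Rightarrow> 'b::ring_1 itself \<Rightarrow> bool" where
  "satisfies_capelli n _ \<longleftrightarrow>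
     (\<forall>x y :: nat \<Rightarrow> 'b.
        (\<Sum>\<pi>\<in>{\<pi>. \<pi> permutes {1..n}}.
           of_int (sign \<pi>) * prod_list (map (\<lambda>i. x (\<pi> i) * y i) [1..<Suc n])) = 0)"

end

(* Multilinearizing the given identity produces a multilinear identity of degree d, so modulo
   identities every multilinear monomial of degree m is a combination of monomials without
   decreasing subsequences of length d. There are at most (d - 1)^(2 m) of these (Regev, Latyshev).

   The group algebra F[S_n] acts on the span of the monomials x_t(1) y_1 ... x_t(n) y_n modulo
   identities by substitution. With M the dimension of this module, M^2 <= (d - 1)^(8 n) < n! for
   n = d', so some nonzero g acts as zero. This g is a strong identity; no representation
   theory of the symmetric group is needed.

   For an affine algebra it suffices to substitute words in the generators into Cap_n. If d' of the
   words have length at least d', split them suitably as p_i q_i and permute the q_i according to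
   g; this expresses the value of Cap_n by values at tuples of words with smaller length sequence.
   Eventually fewer than d' words are long, and two of the short words agree. If r <= 1, there are
   too many short words for this count, but then the algebra is commutative and x_1 x_2 - x_2 x_1
   can serve as the strong identity. *)

theory Submission
  imports Defs "HOL-Combinatorics.Multiset_Permutations" "HOL-Library.Function_Algebras"
    "HOL-Library.Infinite_Set"
begin

section \<open>Words without long decreasing subsequences\<close>

text \<open>Blocks instead of single letters: a decreasing subsequence cuts a word at its letters,
  and whole blocks are later substituted for the variables of the identity.\<close>

definition decreasing_blocks :: "'a::linorder list list \<Rightarrow> bool" where
  "decreasing_blocks bs \<longleftrightarrow> [] \<notin> set bs \<and> sorted_wrt (\<lambda>b c. hd c < hd b) bs"

definition decomposable :: "nat \<Rightarrow> 'a::linorder list \<Rightarrow> bool" where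
  "decomposable d w \<longleftrightarrow> (\<exists>u bs. w = u @ concat bs \<and> length bs = d \<and> decreasing_blocks bs)"

text \<open>For a word with distinct letters, \<open>colour w x\<close> is one less than the length of the longest
  decreasing subsequence of \<open>w\<close> that starts with the letter \<open>x\<close>.\<close>

fun colour :: "'a::linorder list \<Rightarrow> 'a \<Rightarrow> nat" where
  "colour [] = (\<lambda>_. 0)"
| "colour (x # xs) = (colour xs)(x := Max (insert 0 ((\<lambda>y. Suc (colour xs y)) ` {y \<in> set xs. y < x})))"

declare colour.simps(2) [simp del]

lemma colour_Cons_other [simp]: "y \<noteq> x \<Longrightarrow> colour (x # xs) y = colour xs y"
  by (simp add: colour.simps)

lemma colour_Cons_same:
  "colour (x # xs) x = Max (insert 0 ((\<lambda>y. Suc (colour xs y)) ` {y \<in> set xs. y < x}))"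
  by (simp add: colour.simps)

lemma colour_decreasing:
  assumes "distinct (x # xs)" "y \<in> set xs" "y < x"
  shows "colour (x # xs) y < colour (x # xs) x"
proof -
  have "Suc (colour xs y) \<le> Max (insert 0 ((\<lambda>y. Suc (colour xs y)) ` {y \<in> set xs. y < x}))"
    using assms by (intro Max_ge) auto
  then have "Suc (colour xs y) \<le> colour (x # xs) x" unfolding colour_Cons_same .
  then show ?thesis using assms by simp
qed

text \<open>The letter at which the maximum in \<open>colour\<close> is attained starts a chain of
  blocks in the tail; prepending \<open>a\<close> together with everything before that chain gives
  one more block.\<close>

lemma decomposable_colour:
  assumes "distinct w" "x \<in> set w"
  shows "\<exists>u bs. w = u @ concat bs \<and> length bs = Suc (colour w x) \<and> decreasing_blocks bs \<and> hd (hd bs) = x"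
  using assms
proof (induction w arbitrary: x)
  case (Cons a w)
  show ?case
  proof (cases "x = a")
    case False
    with Cons obtain u bs where "w = u @ concat bs" "length bs = Suc (colour w x)"
      "decreasing_blocks bs" "hd (hd bs) = x" by (metis distinct.simps(2) set_ConsD)
    with False show ?thesis by (intro exI[of _ "a # u"] exI[of _ bs]) auto
  next
    case True
    let ?A = "insert 0 ((\<lambda>y. Suc (colour w y)) ` {y \<in> set w. y < a})"
    have "Max ?A \<in> ?A" by (intro Max_in) auto
    then consider "colour (a # w) a = 0"
      | y where "y \<in> set w" "y < a" "colour (a # w) a = Suc (colour w y)"
      unfolding colour_Cons_same by fast
    then show ?thesis
    proof cases
      case 1
      then show ?thesis using True
        by (intro exI[of _ "[]"] exI[of _ "[a # w]"]) (auto simp: decreasing_blocks_def)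
    next
      case 2
      with Cons obtain u bs where bs: "w = u @ concat bs" "length bs = Suc (colour w y)"
        "decreasing_blocks bs" "hd (hd bs) = y" by (metis distinct.simps(2))
      then obtain b bs' where b: "bs = b # bs'" by (cases bs) auto
      have "decreasing_blocks ((a # u) # bs)"
        using bs 2 unfolding b decreasing_blocks_def by force
      then show ?thesis using True bs 2
        by (intro exI[of _ "[]"] exI[of _ "(a # u) # bs"]) auto
    qed
  qed
qed simp

text \<open>Joining trailing blocks into one keeps all remaining heads, so a longer chain also
  yields a decomposition into exactly \<open>k\<close> blocks.\<close>

lemma decreasing_blocks_merge_last:
  assumes "decreasing_blocks bs" "0 < k" "k \<le> length bs"
  shows "\<exists>cs. concat cs = concat bs \<and> length cs = k \<and> decreasing_blocks cs"
  using assms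
proof (induction bs arbitrary: k)
  case (Cons b bs)
  show ?case
  proof (cases "k = 1")
    case True
    then show ?thesis using Cons.prems
      by (intro exI[of _ "[concat (b # bs)]"]) (auto simp: decreasing_blocks_def)
  next
    case False
    have "decreasing_blocks bs" using Cons.prems(1) by (auto simp: decreasing_blocks_def)
    moreover have "0 < k - 1" "k - 1 \<le> length bs" using False Cons.prems by auto
    ultimately obtain cs where cs: "concat cs = concat bs" "length cs = k - 1" "decreasing_blocks cs"
      using Cons.IH by blast
    obtain c cs' e bs' where ce: "cs = c # cs'" "bs = e # bs'"
      using cs \<open>0 < k - 1\<close> \<open>k - 1 \<le> length bs\<close> by (cases cs; cases bs) auto
    \<comment> \<open>The two concatenations agree and their first blocks are nonempty, so both
      heads are the first letter of the same word.\<close>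
    have "hd c = hd e" using cs(1,3) \<open>decreasing_blocks bs\<close>
      unfolding ce decreasing_blocks_def by (metis concat.simps(2) hd_append2 list.set_intros(1))
    then have "decreasing_blocks (b # cs)"
      using cs(3) Cons.prems(1) unfolding ce decreasing_blocks_def by force
    then show ?thesis using cs False Cons.prems by (intro exI[of _ "b # cs"]) auto
  qed
qed auto

lemma colour_less:
  assumes "distinct w" "\<not> decomposable d w" "0 < d" "x \<in> set w"
  shows "Suc (colour w x) < d"
proof (rule ccontr)
  assume "\<not> ?thesis"
  moreover obtain u bs where "w = u @ concat bs" "length bs = Suc (colour w x)" "decreasing_blocks bs"
    using decomposable_colour[OF assms(1,4)] by blast
  ultimately show False using decreasing_blocks_merge_last[of bs d] assms(2,3)
    unfolding decomposable_def by fastforce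
qed

text \<open>The letters of one colour occur in increasing order.\<close>

lemma colour_inj:
  assumes "distinct w" "distinct w'" "set w = set w'"
    and "\<forall>x\<in>set w. colour w x = colour w' x"
    and "map (colour w) w = map (colour w') w'"
  shows "w = w'"
  using assms
proof (induction w arbitrary: w')
  case (Cons a w)
  obtain b v where w': "w' = b # v" using Cons.prems(3) by (cases w') auto
  have col: "colour (a # w) a = colour (b # v) b" using Cons.prems(5) unfolding w' by simp
  have b: "colour (a # w) b = colour (b # v) b" and a: "colour (a # w) a = colour (b # v) a"
    using Cons.prems(3,4) unfolding w' by auto
  \<comment> \<open>If the first letters differed, the smaller one would come later in the word
    headed by the larger and have a strictly smaller colour there, but the two colours
    agree.\<close>
  have "\<not> a < b"
  proof
    assume "a < b"
    moreover have "a \<in> set v" using Cons.prems(3) \<open>a < b\<close> unfolding w' by auto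
    ultimately show False
      using colour_decreasing[of b v a] Cons.prems(2) col a unfolding w' by linarith
  qed
  moreover have "\<not> b < a"
  proof
    assume "b < a"
    moreover have "b \<in> set w" using Cons.prems(3) \<open>b < a\<close> unfolding w' by auto
    ultimately show False
      using colour_decreasing[of a w b] Cons.prems(1) col b by linarith
  qed
  ultimately have ab: "a = b" by auto
  have "set w = set v" using Cons.prems(1-3) ab unfolding w' by auto
  moreover have "colour w x = colour v x" if "x \<in> set w" for x
  proof -
    have "x \<noteq> a" using that Cons.prems(1) by auto
    then show ?thesis using Cons.prems(4) that ab unfolding w' by auto
  qed
  moreover have "map (colour w) w = map (colour v) v"
  proof -
    have "map (colour (a # w)) w = map (colour w) w" "map (colour (b # v)) v = map (colour v) v"
      using Cons.prems(1,2) unfolding w' by (auto intro!: map_cong colour_Cons_other)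
    then show ?thesis using Cons.prems(5) unfolding w' list.map by (metis list.inject)
  qed
  ultimately have "w = v" using Cons.IH[of v] Cons.prems(1,2) unfolding w' by auto
  then show ?case using ab w' by simp
qed simp

text \<open>A word is determined by its colours read letter by letter and place by place. Each
  reading is a sequence of length \<open>card S\<close> over \<open>d - 1\<close> colours.\<close>

lemma card_indecomposable_le:
  fixes S :: "'a::linorder set"
  assumes "finite S" "0 < d"
  shows "card {w \<in> permutations_of_set S. \<not> decomposable d w} \<le> (d - 1) ^ (2 * card S)"
proof -
  let ?G = "{w \<in> permutations_of_set S. \<not> decomposable d w}"
  let ?L = "{xs. set xs \<subseteq> {..<d - 1} \<and> length xs = card S}"
  let ?f = "\<lambda>w. (map (colour w) (sorted_list_of_set S), map (colour w) w)"
  have "inj_on ?f ?G"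
  proof (rule inj_onI)
    fix v w assume vw: "v \<in> ?G" "w \<in> ?G" and eq: "?f v = ?f w"
    have "\<forall>x\<in>set v. colour v x = colour w x"
      using eq vw assms(1) by (auto simp: permutations_of_set_def)
    moreover have "map (colour v) v = map (colour w) w" using eq by simp
    moreover have "distinct v" "distinct w" "set v = set w"
      using vw by (auto simp: permutations_of_set_def)
    ultimately show "v = w" using colour_inj by blast
  qed
  moreover have "?f ` ?G \<subseteq> ?L \<times> ?L"
  proof (rule image_subsetI)
    fix w assume "w \<in> ?G"
    then have w: "w \<in> permutations_of_set S" "\<not> decomposable d w" by auto
    have "colour w x < d - 1" if "x \<in> S" for x
      using colour_less[of w d x] w that assms(2) by (auto simp: permutations_of_set_def)
    then have *: "colour w ` S \<subseteq> {..<d - 1}" by auto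
    moreover have "set w = S" "length w = card S" 
      using w(1) by (auto simp: permutations_of_set_def distinct_card)
    ultimately show "?f w \<in> ?L \<times> ?L" using assms(1) by auto
  qed
  moreover have "finite (?L \<times> ?L)" by (intro finite_cartesian_product finite_lists_length_eq) auto
  ultimately have "card ?G \<le> card (?L \<times> ?L)" by (rule card_inj_on_le)
  also have "\<dots> = (d - 1) ^ (2 * card S)"
    by (simp add: card_cartesian_product card_lists_length_eq mult_2 power_add)
  finally show ?thesis .
qed

text \<open>At the first changed place a later block has moved forward, and its head is smaller
  because heads decrease.\<close>

lemma concat_permuted_blocks_lex:
  assumes "decreasing_blocks bs" "mset cs = mset bs" "cs \<noteq> bs"
  shows "(concat cs, concat bs) \<in> lex {(x, y). x < y}"
  using assms
proof (induction bs arbitrary: cs)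
  case (Cons b bs)
  obtain c cs' where cs: "cs = c # cs'" using Cons.prems(2) by (cases cs) auto
  show ?case
  proof (cases "c = b")
    case True
    have "(concat cs', concat bs) \<in> lex {(x, y). x < y}"
      using Cons.prems True cs by (intro Cons.IH) (auto simp: decreasing_blocks_def)
    then show ?thesis using True cs by (auto intro: lex_append_leftI)
  next
    case False
    then have "c \<in> set bs"
      using Cons.prems(2) cs by (metis list.set_intros(1) mset_eq_setD set_ConsD)
    then have "hd c < hd b" "c \<noteq> []" "b \<noteq> []" using Cons.prems(1) by (auto simp: decreasing_blocks_def)
    then obtain x c' y b' where "c = x # c'" "b = y # b'" "x < y" by (cases c; cases b) auto
    \<comment> \<open>\<open>lex\<close> relates only lists of equal length.\<close>
    moreover have "length (concat cs) = length (concat (b # bs))"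
      using Cons.prems(2) by (simp add: length_concat flip: sum_mset_sum_list)
    ultimately show ?thesis using cs by auto
  qed
qed simp

section \<open>Associative algebras and multilinear identities\<close>

text \<open>Toggling a point of \<open>X - T\<close> pairs sets of opposite sign. This is the
  cancellation behind the inclusion-exclusion in the multilinearization.\<close>

lemma sum_supersets_alternating:
  assumes "finite X" "T \<subseteq> X" "T \<noteq> X"
  shows "(\<Sum>S | T \<subseteq> S \<and> S \<subseteq> X. (-1) ^ card S :: 'a::comm_ring_1) = 0"
proof -
  obtain x where x: "x \<in> X" "x \<notin> T" using assms by auto
  let ?A = "{S. T \<subseteq> S \<and> S \<subseteq> X - {x}}"
  have split: "{S. T \<subseteq> S \<and> S \<subseteq> X} = ?A \<union> insert x ` ?A" (is "?L = ?R")
  proof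
    show "?L \<subseteq> ?R"
    proof
      fix S assume "S \<in> ?L"
      then have "S \<in> ?A \<or> (S - {x} \<in> ?A \<and> S = insert x (S - {x}))" using x by auto
      then show "S \<in> ?R" by blast
    qed
    show "?R \<subseteq> ?L" using x by auto
  qed
  have fin: "finite ?A" using assms(1) by auto
  have inj: "inj_on (insert x) ?A" by (auto simp: inj_on_def)
  have "(\<Sum>S | T \<subseteq> S \<and> S \<subseteq> X. (-1) ^ card S :: 'a)
      = (\<Sum>S\<in>?A. (-1) ^ card S) + (\<Sum>S\<in>insert x ` ?A. (-1) ^ card S)"
    unfolding split using fin by (intro sum.union_disjoint) auto
  also have "(\<Sum>S\<in>insert x ` ?A. (-1) ^ card S :: 'a) = (\<Sum>S\<in>?A. - ((-1) ^ card S))"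
    unfolding sum.reindex[OF inj] comp_def
  proof (rule sum.cong[OF refl])
    fix S assume "S \<in> ?A"
    then have "x \<notin> S" "finite S" using assms(1) finite_subset[of S X] by auto
    then show "(-1) ^ card (insert x S) = - ((-1) ^ card S :: 'a)" by simp
  qed
  finally show ?thesis by (simp add: sum_negf)
qed

lemma sum_fun_apply: "(\<Sum>i\<in>I. f i) x = (\<Sum>i\<in>I. f i x :: 'a::comm_monoid_add)"
  by (induction I rule: infinite_finite_induct) auto

lemma prod_list_concat: "prod_list (concat xss) = prod_list (map prod_list xss)"
  by (induction xss) auto

lemma prod_list_map_sum:
  fixes z :: "'i \<Rightarrow> 'b::semiring_1"
  assumes "finite S"
  shows "prod_list (map (\<lambda>i. \<Sum>j | j \<in> S \<and> h j = i. z j) w)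
    = (\<Sum>v | map h v = w \<and> set v \<subseteq> S. prod_list (map z v))"
proof (induction w)
  case Nil
  have "{v. map h v = [] \<and> set v \<subseteq> S} = {[]}" by auto
  then show ?case by simp
next
  case (Cons a w)
  let ?V = "{v. map h v = w \<and> set v \<subseteq> S}" and ?J = "{j. j \<in> S \<and> h j = a}"
  have "prod_list (map (\<lambda>i. \<Sum>j | j \<in> S \<and> h j = i. z j) (a # w))
      = (\<Sum>j\<in>?J. \<Sum>v\<in>?V. prod_list (map z (j # v)))"
    using Cons.IH by (simp add: sum_product)
  also have "\<dots> = (\<Sum>(j, v)\<in>?J \<times> ?V. prod_list (map z (j # v)))"
    by (simp add: sum.cartesian_product)
  also have "\<dots> = (\<Sum>v | map h v = a # w \<and> set v \<subseteq> S. prod_list (map z v))"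
    by (rule sum.reindex_bij_witness[of _ "\<lambda>v. (hd v, tl v)" "\<lambda>(j, v). j # v"]) auto
  finally show ?case .
qed

locale assoc_algebra = vector_space smul
  for smul :: "'f::field \<Rightarrow> 'b::ring_1 \<Rightarrow> 'b" +
  assumes smul_mult_left: "smul c (x * y) = smul c x * y"
    and smul_mult_right: "smul c (x * y) = x * smul c y"

lemma assoc_algebra_iff: "assoc_algebra smul \<longleftrightarrow> f_algebra smul"
  unfolding assoc_algebra_def assoc_algebra_axioms_def f_algebra_def vector_space_def
  by metis

section \<open>Multilinearization of a polynomial identity\<close>

context assoc_algebra
begin

text \<open>A word \<open>w0\<close> of maximal length gets one new variable per position. Each old
  variable is replaced by the sum of the new ones at its positions within \<open>S\<close>, and the
  alternating sum over \<open>S\<close> keeps only the words in which every new variable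
  occurs.\<close>

lemma has_PI_imp_multilinear:
  assumes "has_PI_of_degree smul d"
  obtains \<alpha> where "\<alpha> [0..<d] \<noteq> 0"
    "\<And>z. (\<Sum>v\<in>permutations_of_set {..<d}. smul (\<alpha> v) (prod_list (map z v))) = 0"
proof -
  obtain p where p: "p \<in> Id_alg smul" "p \<noteq> (\<lambda>_. 0)" "ncdegree p = d"
    using assms unfolding has_PI_of_degree_def by blast
  let ?W = "{w. p w \<noteq> 0}"
  have fin: "finite ?W" and pz: "\<And>a. peval smul p a = 0"
    using p(1) by (auto simp: Id_alg_def ncpoly_def)
  have ne: "?W \<noteq> {}" using p(2) by auto
  have "d \<in> length ` ?W" using Max_in[of "length ` ?W"] fin ne p(3) unfolding ncdegree_def by blast
  then obtain w0 where w0: "p w0 \<noteq> 0" "length w0 = d" by auto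
  have len: "length w \<le> d" if "p w \<noteq> 0" for w
    using Max_ge[of "length ` ?W" "length w"] fin that p(3) by (auto simp: ncdegree_def)
  \<comment> \<open>The coefficient in \<open>p\<close> of the word that \<open>v\<close> becomes
    after returning to the old variables; at \<open>[0..<d]\<close> it is
    \<open>p w0\<close>.\<close>
  define \<alpha> where "\<alpha> v = p (map ((!) w0) v)" for v
  define U where "U = {v. set v \<subseteq> {..<d} \<and> length v \<le> d}"
  have finU: "finite U" unfolding U_def by (rule finite_lists_length_le) simp
  show thesis
  proof
    show "\<alpha> [0..<d] \<noteq> 0" using w0 by (auto simp: \<alpha>_def map_nth)
  next
    fix z :: "nat \<Rightarrow> 'b"
    let ?t = "\<lambda>v. smul (\<alpha> v) (prod_list (map z v))"
    have subst: "(\<Sum>v | v \<in> U \<and> set v \<subseteq> S. ?t v) = 0" if "S \<subseteq> {..<d}" for S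
    proof -
      have finS: "finite S" using that finite_subset by blast
      let ?V = "\<lambda>w. {v. map ((!) w0) v = w \<and> set v \<subseteq> S}"
      have finV: "finite (?V w)" for w
        by (rule finite_subset[OF _ finite_lists_length_eq[OF finS, of "length w"]]) auto
      have "0 = peval smul p (\<lambda>i. \<Sum>j | j \<in> S \<and> w0 ! j = i. z j)" using pz by simp
      also have "\<dots> = (\<Sum>w\<in>?W. \<Sum>v\<in>?V w. ?t v)"
        unfolding peval_def prod_list_map_sum[OF finS]
        by (intro sum.cong refl) (auto simp: scale_sum_right \<alpha>_def intro: sum.cong)
      also have "\<dots> = (\<Sum>v\<in>(\<Union>w\<in>?W. ?V w). ?t v)"
        using fin finV by (intro sum.UNION_disjoint[symmetric]) auto
      also have "\<dots> = (\<Sum>v | v \<in> U \<and> set v \<subseteq> S. ?t v)"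
      proof (rule sum.mono_neutral_left)
        show "finite {v \<in> U. set v \<subseteq> S}" using finU by simp
        show "(\<Union>w\<in>?W. ?V w) \<subseteq> {v \<in> U. set v \<subseteq> S}"
          using that len by (fastforce simp: U_def)
        show "\<forall>v\<in>{v \<in> U. set v \<subseteq> S} - (\<Union>w\<in>?W. ?V w). ?t v = 0"
          by (auto simp: \<alpha>_def)
      qed
      finally show ?thesis by simp
    qed
    have supersets: "(\<Sum>S | set v \<subseteq> S \<and> S \<subseteq> {..<d}. (-1) ^ card S :: 'f)
        = (if set v = {..<d} then (-1) ^ d else 0)" if "v \<in> U" for v
    proof (cases "set v = {..<d}")
      case True
      then have "{S. set v \<subseteq> S \<and> S \<subseteq> {..<d}} = {{..<d}}" by auto
      with True show ?thesis by simp
    qed (use that sum_supersets_alternating[of "{..<d}" "set v"] in \<open>auto simp: U_def\<close>)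
    \<comment> \<open>No word is longer than \<open>d\<close>, so using all \<open>d\<close>
      variables leaves room for each only once.\<close>
    have perms: "{v \<in> U. set v = {..<d}} = permutations_of_set {..<d}"
    proof -
      have "distinct v" if "set v = {..<d}" "length v \<le> d" for v
        using that card_length[of v] by (intro card_distinct) auto
      moreover have "length v \<le> d" if "set v = {..<d}" "distinct v" for v
        using that distinct_card[of v] by simp
      ultimately show ?thesis by (auto simp: U_def permutations_of_set_def)
    qed
    have "0 = (\<Sum>S\<in>Pow {..<d}. smul ((-1) ^ card S) (\<Sum>v | v \<in> U \<and> set v \<subseteq> S. ?t v))"
      using subst by (auto intro: sum.neutral)
    also have "\<dots> = (\<Sum>S\<in>Pow {..<d}. \<Sum>v | v \<in> U \<and> set v \<subseteq> S. smul ((-1) ^ card S) (?t v))"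
      by (simp add: scale_sum_right)
    also have "\<dots> = (\<Sum>v\<in>U. \<Sum>S | S \<in> Pow {..<d} \<and> set v \<subseteq> S. smul ((-1) ^ card S) (?t v))"
      using finU by (intro sum.swap_restrict) auto
    also have "\<dots> = (\<Sum>v\<in>U. smul (\<Sum>S | set v \<subseteq> S \<and> S \<subseteq> {..<d}. (-1) ^ card S) (?t v))"
      unfolding scale_sum_left by (intro sum.cong) auto
    also have "\<dots> = (\<Sum>v\<in>U. if set v = {..<d} then smul ((-1) ^ d) (?t v) else 0)"
      by (intro sum.cong) (auto simp: supersets)
    also have "\<dots> = smul ((-1) ^ d) (\<Sum>v\<in>permutations_of_set {..<d}. ?t v)"
      using finU unfolding perms[symmetric] by (auto simp: sum.inter_filter scale_sum_right intro: sum.cong)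
    finally show "(\<Sum>v\<in>permutations_of_set {..<d}. ?t v) = 0" by simp
  qed
qed

text \<open>For \<open>d \<le> 1\<close> there is a single term, and substituting ones would make a
  nonzero multiple of \<open>1\<close> vanish; \<open>1\<close> is nonzero in
  \<open>ring_1\<close>.\<close>

lemma multilinear_identity_degree_ge_2:
  assumes "\<alpha> [0..<d] \<noteq> 0"
    and "\<And>z. (\<Sum>v\<in>permutations_of_set {..<d}. smul (\<alpha> v) (prod_list (map z v))) = 0"
  shows "2 \<le> d"
proof (rule ccontr)
  assume "\<not> 2 \<le> d"
  then consider "d = 0" | "d = 1" by linarith
  then have "permutations_of_set {..<d} = {[0..<d]}" by cases (simp_all add: lessThan_Suc)
  then show False using assms(2)[of "\<lambda>_. 1"] assms(1) by (simp add: map_replicate_const)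
qed

text \<open>Scalar multiplication on functions of a variable assignment; monomials are elements
  of this vector space, and identities are linear relations between them.\<close>

sublocale funs: vector_space "\<lambda>c (f :: (nat \<Rightarrow> 'b) \<Rightarrow> 'b) z. smul c (f z)"
  by unfold_locales (auto simp: fun_eq_iff scale_right_distrib scale_left_distrib)

section \<open>Rewriting monomials modulo a multilinear identity\<close>

definition monom :: "nat list \<Rightarrow> (nat \<Rightarrow> 'b) \<Rightarrow> 'b" where
  "monom w z = prod_list (map z w)"

text \<open>Substituting the blocks of a decomposable word into the identity expresses it by words
  with permuted blocks. These are lexicographically smaller, so the rewriting terminates.\<close>

lemma monom_in_span_indecomposable:
  assumes \<alpha>: "\<alpha> [0..<d] \<noteq> 0"
    and id: "\<And>z. (\<Sum>v\<in>permutations_of_set {..<d}. smul (\<alpha> v) (prod_list (map z v))) = 0"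
    and "w \<in> permutations_of_set S"
  shows "monom w \<in> funs.span (monom ` {u \<in> permutations_of_set S. \<not> decomposable d u})"
proof -
  have "wf (lex {(x::nat, y). x < y})" by (intro wf_lex wf)
  then show ?thesis using assms(3)
  proof (induction w rule: wf_induct_rule)
    case (less w)
    show ?case
    proof (cases "decomposable d w")
      case True
      then obtain u bs where w: "w = u @ concat bs" "length bs = d" "decreasing_blocks bs"
        unfolding decomposable_def by blast
      let ?P = "permutations_of_set {..<d}"
      let ?w = "\<lambda>v. u @ concat (map ((!) bs) v)"
      have idP: "[0..<d] \<in> ?P" by (auto intro!: permutations_of_setI)
      have nth_id: "map ((!) bs) [0..<d] = bs" using w(2) map_nth by blast
      have w_id: "?w [0..<d] = w" using w(1) nth_id by simp
      \<comment> \<open>Heads decrease strictly, so the blocks are pairwise distinct and a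
        nontrivial permutation of the indices really changes the list of blocks.\<close>
      have dist: "distinct bs"
      proof -
        have "distinct (rev (map hd bs))"
          using w(3) by (intro strict_sorted_iff[THEN iffD1, THEN conjunct2])
            (simp add: decreasing_blocks_def sorted_wrt_rev sorted_wrt_map)
        then show ?thesis by (simp add: distinct_map)
      qed
      have in_span: "monom (?w v) \<in> funs.span (monom ` {u \<in> permutations_of_set S. \<not> decomposable d u})"
        if "v \<in> ?P" "v \<noteq> [0..<d]" for v
      proof (rule less.IH)
        have "set v = set [0..<d]" "distinct v"
          using permutations_of_setD[OF that(1)] by (simp_all add: atLeast0LessThan)
        then have "mset v = mset [0..<d]" by (metis mset_set_set distinct_upt)
        then have "mset (map ((!) bs) v) = mset (map ((!) bs) [0..<d])" by (simp only: mset_map)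
        then have m: "mset (map ((!) bs) v) = mset bs" using nth_id by simp
        have "map ((!) bs) v \<noteq> bs"
        proof
          assume eq: "map ((!) bs) v = bs"
          have "length v = d" using eq w(2) by (metis length_map)
          moreover have "v ! i = i" if "i < d" for i
          proof -
            have "bs ! (v ! i) = bs ! i" using eq that \<open>length v = d\<close> by (metis nth_map)
            moreover have "v ! i < d"
              using \<open>v \<in> ?P\<close> that \<open>length v = d\<close> nth_mem[of i v] by (auto simp: permutations_of_set_def)
            ultimately show ?thesis using dist that w(2) by (simp add: nth_eq_iff_index_eq)
          qed
          ultimately have "v = [0..<d]" by (intro nth_equalityI) auto
          with that(2) show False by simp
        qed
        with m w(3) show "(?w v, w) \<in> lex {(x, y). x < y}"
          unfolding w(1) by (intro lex_append_leftI concat_permuted_blocks_lex) auto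
        have "mset (concat (map ((!) bs) v)) = mset (concat bs)"
          using m by (metis mset_concat mset_map sum_mset_sum_list)
        then have "mset (?w v) = mset w" unfolding w(1) by simp
        then show "?w v \<in> permutations_of_set S"
          using less.prems mset_eq_setD mset_eq_imp_distinct_iff
          unfolding permutations_of_set_def by blast
      qed
      have sum0: "(\<Sum>v\<in>?P. smul (\<alpha> v) (monom (?w v) z)) = 0" for z
      proof -
        have "(\<Sum>v\<in>?P. smul (\<alpha> v) (monom (?w v) z))
            = prod_list (map z u) * (\<Sum>v\<in>?P. smul (\<alpha> v) (prod_list (map (\<lambda>i. prod_list (map z (bs ! i))) v)))"
          unfolding sum_distrib_left
          by (intro sum.cong refl)
            (simp add: monom_def map_concat prod_list_concat comp_def flip: smul_mult_right)
        then show ?thesis using id by simp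
      qed
      \<comment> \<open>The identity is solved for the term of \<open>[0..<d]\<close>, which is
        \<open>w\<close> itself.\<close>
      have "monom w = (\<Sum>v\<in>?P - {[0..<d]}. (\<lambda>z. smul (- \<alpha> v / \<alpha> [0..<d]) (monom (?w v) z)))"
      proof
        fix z
        have "smul (\<alpha> [0..<d]) (monom w z) = - (\<Sum>v\<in>?P - {[0..<d]}. smul (\<alpha> v) (monom (?w v) z))"
          using sum0[of z] sum.remove[OF _ idP, of "\<lambda>v. smul (\<alpha> v) (monom (?w v) z)"] w_id
          by (simp add: eq_neg_iff_add_eq_0)
        then have "smul (inverse (\<alpha> [0..<d])) (smul (\<alpha> [0..<d]) (monom w z))
            = (\<Sum>v\<in>?P - {[0..<d]}. smul (- \<alpha> v / \<alpha> [0..<d]) (monom (?w v) z))"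
          by (simp add: scale_sum_right divide_inverse mult.commute flip: sum_negf)
        then show "monom w z = (\<Sum>v\<in>?P - {[0..<d]}. (\<lambda>z. smul (- \<alpha> v / \<alpha> [0..<d]) (monom (?w v) z))) z"
          using \<alpha> by (simp add: sum_fun_apply)
      qed
      also have "\<dots> \<in> funs.span (monom ` {u \<in> permutations_of_set S. \<not> decomposable d u})"
        using in_span by (intro funs.span_sum funs.span_scale) auto
      finally show ?thesis .
    qed (use less.prems in \<open>simp add: funs.span_base\<close>)
  qed
qed

end

declare upt_Suc [simp del]

section \<open>Annihilators in the group algebra\<close>

text \<open>Gaussian elimination: a column \<open>p\<close> with nonzero entry in row
  \<open>i\<close> is cleared from the other rows, and the unknown at \<open>p\<close> is recovered
  from row \<open>i\<close>.\<close>

lemma underdetermined_system: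
  fixes a :: "'i \<Rightarrow> 'j \<Rightarrow> 'f::field"
  assumes "finite I" "finite J" "card I < card J"
  shows "\<exists>x. (\<exists>j\<in>J. x j \<noteq> 0) \<and> (\<forall>i\<in>I. (\<Sum>j\<in>J. a i j * x j) = 0)"
  using assms
proof (induction I arbitrary: J a rule: finite_induct)
  case empty
  then obtain j where "j \<in> J" by fastforce
  then show ?case by (intro exI[of _ "\<lambda>_. 1"]) auto
next
  case (insert i I)
  show ?case
  proof (cases "\<forall>j\<in>J. a i j = 0")
    case True
    obtain x where "\<exists>j\<in>J. x j \<noteq> 0" "\<forall>k\<in>I. (\<Sum>j\<in>J. a k j * x j) = 0"
      using insert.IH[of J a] insert.prems insert.hyps by auto
    then show ?thesis using True by (intro exI[of _ x]) auto
  next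
    case False
    then obtain p where p: "p \<in> J" "a i p \<noteq> 0" by blast
    let ?J = "J - {p}"
    have "card I < card ?J" using insert.prems insert.hyps p by auto
    then obtain x where x: "\<exists>j\<in>?J. x j \<noteq> 0"
      "\<forall>k\<in>I. (\<Sum>j\<in>?J. (a k j - a k p * a i j / a i p) * x j) = 0"
      using insert.IH[of ?J "\<lambda>k j. a k j - a k p * a i j / a i p"] insert.prems by auto
    define y where "y = x(p := - (\<Sum>j\<in>?J. a i j * x j) / a i p)"
    have split: "(\<Sum>j\<in>J. a k j * y j)
        = a k p * (- (\<Sum>j\<in>?J. a i j * x j) / a i p) + (\<Sum>j\<in>?J. a k j * x j)" for k
    proof -
      have "(\<Sum>j\<in>?J. a k j * y j) = (\<Sum>j\<in>?J. a k j * x j)" by (rule sum.cong) (auto simp: y_def)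
      then show ?thesis using sum.remove[OF insert.prems(1) p(1), of "\<lambda>j. a k j * y j"]
        by (simp add: y_def)
    qed
    have "(\<Sum>j\<in>J. a k j * y j) = 0" if "k \<in> insert i I" for k
    proof (cases "k = i")
      case True
      then show ?thesis using split[of i] p by simp
    next
      case False
      then have "0 = (\<Sum>j\<in>?J. (a k j - a k p * a i j / a i p) * x j)" using x(2) that by auto
      also have "\<dots> = (\<Sum>j\<in>?J. a k j * x j) - a k p * (\<Sum>j\<in>?J. a i j * x j) / a i p"
        by (simp add: left_diff_distrib sum_subtractf sum_distrib_left sum_divide_distrib mult.assoc)
      finally show ?thesis using split[of k] by simp
    qed
    moreover have "\<exists>j\<in>J. y j \<noteq> 0" using x(1) by (auto simp: y_def)
    ultimately show ?thesis by blast
  qed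
qed

text \<open>The variables \<open>n + 1\<close> to \<open>2 * n\<close> play the part of y_1, ...,
  y_n: arbitrary coefficients between the permuted variables, fixed by permutations of
  \<open>{1..n}\<close>.\<close>

definition interleave :: "nat \<Rightarrow> nat list \<Rightarrow> nat list" where
  "interleave n v = concat (map2 (\<lambda>a j. [a, j]) v [Suc n..<Suc (2 * n)])"

lemma interleave_permutation:
  assumes "v \<in> permutations_of_set {1..n}"
  shows "interleave n v \<in> permutations_of_set {1..2 * n}"
proof -
  let ?js = "[Suc n..<Suc (2 * n)]"
  have v: "set v = {1..n}" "length v = length ?js"
    using assms by (auto simp: permutations_of_set_def dest: distinct_card)
  have *: "length (concat (map2 (\<lambda>a j. [a, j]) v js)) = length v + length js"
    "set (concat (map2 (\<lambda>a j. [a, j]) v js)) = set v \<union> set js"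
    if "length v = length js" for v js :: "nat list"
    using that by (induction v js rule: list_induct2) auto
  have "set (interleave n v) = {1..2 * n}" "length (interleave n v) = 2 * n"
    using v *[OF v(2)] unfolding interleave_def by auto
  then show ?thesis by (auto simp: permutations_of_set_def intro: card_distinct)
qed

lemma map_interleave:
  assumes "\<tau> permutes {1..n}"
  shows "map \<tau> (interleave n v) = interleave n (map \<tau> v)"
proof -
  have "map \<tau> (concat (map2 (\<lambda>a j. [a, j]) v js)) = concat (map2 (\<lambda>a j. [a, j]) (map \<tau> v) js)"
    if "set js \<subseteq> {n<..}" for js using that
  proof (induction v arbitrary: js)
    case (Cons a v)
    then show ?case using permutes_not_in[OF assms] by (cases js) auto
  qed simp
  moreover have "set [Suc n..<Suc (2 * n)] \<subseteq> {n<..}" by auto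
  ultimately show ?thesis unfolding interleave_def by blast
qed

lemma prod_list_interleave:
  fixes f :: "nat \<Rightarrow> 'b::monoid_mult"
  assumes "length v = n" "length ys = n" "\<And>j. j < n \<Longrightarrow> f (Suc (n + j)) = ys ! j"
  shows "prod_list (map f (interleave n v)) = prod_list (map2 (\<lambda>a y. f a * y) v ys)"
proof -
  have "prod_list (map f (concat (map2 (\<lambda>a j. [a, j]) v js)))
      = prod_list (map2 (\<lambda>a y. f a * y) v (map f js))"
    if "length v = length js" for js using that
    by (induction v js rule: list_induct2) (auto simp: mult.assoc)
  moreover have "map f [Suc n..<Suc (2 * n)] = ys"
    using assms(2,3) by (intro nth_equalityI) auto
  ultimately show ?thesis using assms(1) unfolding interleave_def by simp
qed

text \<open>\<open>Inl\<close> marks variables and \<open>Inr\<close> constants. Each run of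
  constants is multiplied into one coefficient, with \<open>1\<close> for an empty run, which gives
  an interleaved monomial with a coefficient in front.\<close>

lemma monomial_with_constants:
  fixes v :: "('a + 'b::monoid_mult) list"
  shows "\<exists>y ys. length ys = length (filter isl v) \<and>
    (\<forall>x. prod_list (map (case_sum x (\<lambda>b. b)) v)
      = y * prod_list (map2 (\<lambda>a y. x a * y) (map projl (filter isl v)) ys))"
proof (induction v)
  case Nil
  then show ?case by (intro exI[of _ 1] exI[of _ "[]"]) auto
next
  case (Cons c v)
  then obtain y ys where IH: "length ys = length (filter isl v)"
    "\<And>x. prod_list (map (case_sum x (\<lambda>b. b)) v)
      = y * prod_list (map2 (\<lambda>a y. x a * y) (map projl (filter isl v)) ys)" by blast
  show ?case
  proof (cases c)
    case (Inl a)
    then show ?thesis using IH by (intro exI[of _ 1] exI[of _ "y # ys"]) (auto simp: mult.assoc)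
  next
    case (Inr b)
    then show ?thesis using IH by (intro exI[of _ "b * y"] exI[of _ ys]) (auto simp: mult.assoc)
  qed
qed

section \<open>Elements of the group algebra that annihilate all monomials\<close>

context assoc_algebra
begin

text \<open>The two-sided ideal generated by \<open>g\<close> consists of identities: \<open>g\<close> acts on the variables
  (the left injections), which may stand at arbitrary places between constants.\<close>

definition universal_annihilator :: "nat \<Rightarrow> ((nat \<Rightarrow> nat) \<Rightarrow> 'f) \<Rightarrow> bool" where
  "universal_annihilator n g \<longleftrightarrow>
    (\<forall>v :: (nat + 'b) list. map projl (filter isl v) \<in> permutations_of_set {1..n} \<longrightarrow>
      (\<forall>x. (\<Sum>\<tau> | \<tau> permutes {1..n}. smul (g \<tau>) (prod_list (map (case_sum (x \<circ> \<tau>) (\<lambda>b. b)) v))) = 0))"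

text \<open>After merging the constants, each word is a left multiple of an interleaved monomial
  whose separating variables take the merged coefficients as values.\<close>

lemma universal_annihilatorI:
  assumes "\<And>v z. v \<in> permutations_of_set {1..n} \<Longrightarrow>
    (\<Sum>\<tau> | \<tau> permutes {1..n}. smul (g \<tau>) (monom (interleave n v) (z \<circ> \<tau>))) = 0"
  shows "universal_annihilator n g"
  unfolding universal_annihilator_def
proof (intro allI impI)
  fix v :: "(nat + 'b) list" and x
  let ?u = "map projl (filter isl v)"
  assume u: "?u \<in> permutations_of_set {1..n}"
  then have lu: "length ?u = n" "set ?u = {1..n}"
    by (auto simp: permutations_of_set_def dest: distinct_card)
  obtain y ys where ys: "length ys = length (filter isl v)"
    "\<And>x. prod_list (map (case_sum x (\<lambda>b. b)) v) = y * prod_list (map2 (\<lambda>a y. x a * y) ?u ys)"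
    using monomial_with_constants[of v] by blast
  define z where "z i = (if i \<le> n then x i else ys ! (i - Suc n))" for i
  have "prod_list (map (case_sum (x \<circ> \<tau>) (\<lambda>b. b)) v) = y * monom (interleave n ?u) (z \<circ> \<tau>)"
    if "\<tau> permutes {1..n}" for \<tau>
  proof -
    have "map (z \<circ> \<tau>) (interleave n ?u) = map z (interleave n (map \<tau> ?u))"
      using map_interleave[OF that, of ?u] by (metis map_map)
    moreover have "prod_list (map z (interleave n (map \<tau> ?u)))
        = prod_list (map2 (\<lambda>a y. z a * y) (map \<tau> ?u) ys)"
      using lu ys by (intro prod_list_interleave) (auto simp: z_def)
    moreover have "map2 (\<lambda>a y. z a * y) (map \<tau> ?u) ys = map2 (\<lambda>a y. (x \<circ> \<tau>) a * y) ?u ys"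
    proof -
      have "z (\<tau> a) = x (\<tau> a)" if "a \<in> set ?u" for a
        using that lu(2) permutes_in_image[OF \<open>\<tau> permutes {1..n}\<close>, of a] by (simp add: z_def)
      then show ?thesis by (auto simp: zip_map1 dest: set_zip_leftD)
    qed
    ultimately show ?thesis using ys(2) unfolding monom_def by metis
  qed
  then have "(\<Sum>\<tau> | \<tau> permutes {1..n}. smul (g \<tau>) (prod_list (map (case_sum (x \<circ> \<tau>) (\<lambda>b. b)) v)))
      = y * (\<Sum>\<tau> | \<tau> permutes {1..n}. smul (g \<tau>) (monom (interleave n ?u) (z \<circ> \<tau>)))"
    unfolding sum_distrib_left by (intro sum.cong) (auto simp: smul_mult_right)
  then show "(\<Sum>\<tau> | \<tau> permutes {1..n}. smul (g \<tau>) (prod_list (map (case_sum (x \<circ> \<tau>) (\<lambda>b. b)) v))) = 0"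
    using assms[OF u] by simp
qed

text \<open>The group algebra acts on the span of the interleaved monomials. This module has dimension
  \<open>M \<le> (d - 1) ^ (4 * n)\<close>, so its endomorphism ring has dimension \<open>M\<^sup>2 < n!\<close> and the action
  of the group algebra has a kernel.\<close>

lemma universal_annihilator_exists:
  assumes \<alpha>: "\<alpha> [0..<d] \<noteq> 0"
    and id: "\<And>z. (\<Sum>v\<in>permutations_of_set {..<d}. smul (\<alpha> v) (prod_list (map z v))) = 0"
    and d: "0 < d" and n: "(d - 1) ^ (8 * n) < fact n"
  obtains g where "g \<in> grp_alg n" "g \<noteq> (\<lambda>_. 0)" "universal_annihilator n g"
proof -
  let ?P = "{\<tau>. \<tau> permutes {1..n}}"
  let ?V = "(\<lambda>v. monom (interleave n v)) ` permutations_of_set {1..n}"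
  let ?G = "monom ` {u \<in> permutations_of_set {1..2 * n}. \<not> decomposable d u}"
  have finP: "finite ?P" by (simp add: finite_permutations)
  \<comment> \<open>The basis is chosen among the interleaved monomials themselves, so a permutation
    of the variables sends each basis vector to another such monomial.\<close>
  obtain B where B: "B \<subseteq> ?V" "funs.independent B" "?V \<subseteq> funs.span B"
    using funs.maximal_independent_subset by blast
  have finB: "finite B" using B(1) by (rule finite_subset) simp
  have finG: "finite ?G" by simp
  have "B \<subseteq> funs.span ?G"
    using B(1) monom_in_span_indecomposable[OF \<alpha> id interleave_permutation] by blast
  then have "card B \<le> card ?G" using funs.independent_span_bound[OF finG B(2)] by blast
  also have "\<dots> \<le> card {u \<in> permutations_of_set {1..2 * n}. \<not> decomposable d u}"
    by (rule card_image_le) simp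
  also have "\<dots> \<le> (d - 1) ^ (4 * n)"
    using card_indecomposable_le[OF _ d, of "{1..2 * n}"] by simp
  finally have "card (B \<times> B) \<le> (d - 1) ^ (4 * n) * (d - 1) ^ (4 * n)"
    by (simp add: card_cartesian_product mult_mono)
  also have "\<dots> = (d - 1) ^ (8 * n)" by (simp flip: power_add)
  finally have cardB: "card (B \<times> B) < card ?P"
    using n by (simp add: card_permutations)
  have act: "(\<lambda>z. f (z \<circ> \<tau>)) \<in> funs.span B" if f: "f \<in> ?V" and \<tau>: "\<tau> permutes {1..n}" for f \<tau>
  proof -
    obtain v where v: "v \<in> permutations_of_set {1..n}" "f = monom (interleave n v)" using f by auto
    have "f (z \<circ> \<tau>) = monom (interleave n (map \<tau> v)) z" for z
      unfolding v(2) monom_def by (simp flip: map_interleave[OF \<tau>])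
    moreover have "map \<tau> v \<in> permutations_of_set {1..n}"
      using v(1) \<tau> by (auto simp: permutations_of_set_def distinct_map permutes_image
          intro: inj_on_subset[OF permutes_inj])
    ultimately show ?thesis using B(3) by auto
  qed
  have coords: "\<exists>c. f = (\<Sum>b\<in>B. (\<lambda>z. smul (c b) (b z)))" if "f \<in> funs.span B" for f
    using that funs.span_finite[OF finB] by auto
  define c where "c f = (SOME k. f = (\<Sum>b\<in>B. (\<lambda>z. smul (k b) (b z))))" for f
  have c: "f = (\<Sum>b\<in>B. (\<lambda>z. smul (c f b) (b z)))" if "f \<in> funs.span B" for f
    unfolding c_def using someI_ex[OF coords[OF that]] .
  let ?c = "\<lambda>b \<tau>. c (\<lambda>z. b (z \<circ> \<tau>))"
  \<comment> \<open>One equation for each matrix entry of the action on \<open>B\<close>, one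
    unknown for each permutation: the solution \<open>g\<close> acts as zero.\<close>
  obtain g where g: "\<exists>\<tau>\<in>?P. g \<tau> \<noteq> 0"
    "\<And>b b'. b \<in> B \<Longrightarrow> b' \<in> B \<Longrightarrow> (\<Sum>\<tau>\<in>?P. ?c b \<tau> b' * g \<tau>) = 0"
    using underdetermined_system[OF _ finP cardB, of "\<lambda>(b, b') \<tau>. ?c b \<tau> b'"] finB by auto
  have annB: "(\<Sum>\<tau>\<in>?P. smul (g \<tau>) (b (z \<circ> \<tau>))) = 0" if "b \<in> B" for b z
  proof -
    have "(\<Sum>\<tau>\<in>?P. smul (g \<tau>) (b (z \<circ> \<tau>)))
        = (\<Sum>\<tau>\<in>?P. \<Sum>b'\<in>B. smul (?c b \<tau> b' * g \<tau>) (b' z))"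
    proof (rule sum.cong[OF refl])
      fix \<tau> assume "\<tau> \<in> ?P"
      then have "(\<lambda>z. b (z \<circ> \<tau>)) \<in> funs.span B" using act B(1) that by blast
      from fun_cong[OF c[OF this], of z]
      have "b (z \<circ> \<tau>) = (\<Sum>b'\<in>B. smul (?c b \<tau> b') (b' z))" by (simp add: sum_fun_apply)
      then show "smul (g \<tau>) (b (z \<circ> \<tau>)) = (\<Sum>b'\<in>B. smul (?c b \<tau> b' * g \<tau>) (b' z))"
        by (simp add: scale_sum_right mult.commute)
    qed
    also have "\<dots> = (\<Sum>b'\<in>B. smul (\<Sum>\<tau>\<in>?P. ?c b \<tau> b' * g \<tau>) (b' z))"
      by (subst sum.swap) (simp add: scale_sum_left)
    finally show ?thesis using g(2) that by simp
  qed
  \<comment> \<open>The system controls \<open>g\<close> only on permutations of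
    \<open>{1..n}\<close>; the value zero elsewhere puts it into \<open>grp_alg n\<close>.\<close>
  let ?g = "\<lambda>\<tau>. if \<tau> \<in> ?P then g \<tau> else 0"
  show thesis
  proof
    show "?g \<in> grp_alg n" "?g \<noteq> (\<lambda>_. 0)" using g(1) by (auto simp: grp_alg_def fun_eq_iff)
    show "universal_annihilator n ?g"
    proof (rule universal_annihilatorI)
      fix v z assume "v \<in> permutations_of_set {1..n}"
      then obtain k where k: "monom (interleave n v) = (\<Sum>b\<in>B. (\<lambda>z. smul (k b) (b z)))"
        using coords B(3) by blast
      have "(\<Sum>\<tau>\<in>?P. smul (?g \<tau>) (monom (interleave n v) (z \<circ> \<tau>)))
          = (\<Sum>\<tau>\<in>?P. \<Sum>b\<in>B. smul (k b) (smul (g \<tau>) (b (z \<circ> \<tau>))))"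
        unfolding k by (intro sum.cong refl)
          (simp add: sum_fun_apply scale_sum_right mult.commute)
      also have "\<dots> = (\<Sum>b\<in>B. smul (k b) (\<Sum>\<tau>\<in>?P. smul (g \<tau>) (b (z \<circ> \<tau>))))"
        by (subst sum.swap) (simp add: scale_sum_right)
      finally show "(\<Sum>\<tau>\<in>?P. smul (?g \<tau>) (monom (interleave n v) (z \<circ> \<tau>))) = 0"
        using annB by simp
    qed
  qed
qed

section \<open>Evaluation of group algebra elements and strong identities\<close>

definition eval_ga :: "nat \<Rightarrow> ((nat \<Rightarrow> nat) \<Rightarrow> 'f) \<Rightarrow> (nat \<Rightarrow> 'b) \<Rightarrow> 'b" where
  "eval_ga m c z = (\<Sum>\<tau> | \<tau> permutes {1..m}. smul (c \<tau>) (prod_list (map (z \<circ> \<tau>) [1..<Suc m])))"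

lemma support_poly_of_ga:
  "{w. poly_of_ga m c w \<noteq> 0} \<subseteq> (\<lambda>\<tau>. map \<tau> [1..<Suc m]) ` {\<tau>. \<tau> permutes {1..m}}"
proof (rule subsetI, rule ccontr)
  fix w assume w: "w \<in> {w. poly_of_ga m c w \<noteq> 0}" "w \<notin> (\<lambda>\<tau>. map \<tau> [1..<Suc m]) ` {\<tau>. \<tau> permutes {1..m}}"
  from w(2) have "poly_of_ga m c w = 0" unfolding poly_of_ga_def by (intro sum.neutral) auto
  with w(1) show False by simp
qed

lemma ncpoly_poly_of_ga: "ncpoly (poly_of_ga m c)"
  unfolding ncpoly_def by (rule finite_subset[OF support_poly_of_ga]) (simp add: finite_permutations)

lemma peval_poly_of_ga: "peval smul (poly_of_ga m c) z = eval_ga m c z"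
proof -
  let ?P = "{\<tau>. \<tau> permutes {1..m}}" and ?w = "\<lambda>\<tau>. map \<tau> [1..<Suc m]"
  have fin: "finite ?P" by (simp add: finite_permutations)
  have "peval smul (poly_of_ga m c) z = (\<Sum>w\<in>?w ` ?P. smul (poly_of_ga m c w) (prod_list (map z w)))"
    unfolding peval_def
  proof (rule sum.mono_neutral_left)
    show "{w. poly_of_ga m c w \<noteq> 0} \<subseteq> ?w ` ?P" by (rule support_poly_of_ga)
  qed (use fin in auto)
  also have "\<dots> = (\<Sum>w\<in>?w ` ?P. \<Sum>\<tau> | \<tau> \<in> ?P \<and> ?w \<tau> = w. smul (c \<tau>) (prod_list (map z (?w \<tau>))))"
  proof (rule sum.cong[OF refl])
    fix w
    have "poly_of_ga m c w = (\<Sum>\<tau> | \<tau> \<in> ?P \<and> ?w \<tau> = w. c \<tau>)"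
      unfolding poly_of_ga_def by (rule sum.inter_filter[OF fin, symmetric])
    then show "smul (poly_of_ga m c w) (prod_list (map z w))
        = (\<Sum>\<tau> | \<tau> \<in> ?P \<and> ?w \<tau> = w. smul (c \<tau>) (prod_list (map z (?w \<tau>))))"
      by (auto simp: scale_sum_left intro: sum.cong)
  qed
  also have "\<dots> = eval_ga m c z"
    unfolding eval_ga_def
    by (subst sum.group[OF fin finite_imageI[OF fin] order.refl]) (simp only: map_map)
  finally show ?thesis .
qed

lemma sum_ga_mult:
  "(\<Sum>\<rho> | \<rho> permutes {1..m}. smul (ga_mult m a b \<rho>) (h \<rho>))
    = (\<Sum>\<sigma> | \<sigma> permutes {1..m}. smul (a \<sigma>) (\<Sum>\<tau> | \<tau> permutes {1..m}. smul (b \<tau>) (h (\<sigma> \<circ> \<tau>))))"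
proof -
  let ?P = "{\<tau>. \<tau> permutes {1..m}}"
  have "(\<Sum>\<rho>\<in>?P. smul (ga_mult m a b \<rho>) (h \<rho>))
      = (\<Sum>\<sigma>\<in>?P. \<Sum>\<rho>\<in>?P. smul (a \<sigma> * b (inv \<sigma> \<circ> \<rho>)) (h \<rho>))"
    unfolding ga_mult_def scale_sum_left by (rule sum.swap)
  also have "\<dots> = (\<Sum>\<sigma>\<in>?P. \<Sum>\<tau>\<in>?P. smul (a \<sigma> * b \<tau>) (h (\<sigma> \<circ> \<tau>)))"
  proof (rule sum.cong[OF refl])
    fix \<sigma> assume "\<sigma> \<in> ?P"
    then have \<sigma>: "\<sigma> permutes {1..m}" by simp
    show "(\<Sum>\<rho>\<in>?P. smul (a \<sigma> * b (inv \<sigma> \<circ> \<rho>)) (h \<rho>)) = (\<Sum>\<tau>\<in>?P. smul (a \<sigma> * b \<tau>) (h (\<sigma> \<circ> \<tau>)))"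
      using \<sigma> permutes_inv[OF \<sigma>]
      by (intro sum.reindex_bij_witness[of _ "\<lambda>\<tau>. \<sigma> \<circ> \<tau>" "\<lambda>\<rho>. inv \<sigma> \<circ> \<rho>"])
        (auto simp: permutes_compose comp_assoc[symmetric] permutes_inv_o)
  qed
  finally show ?thesis by (simp add: scale_sum_right)
qed

text \<open>The right factor reorders the places of a monomial and the left factor only changes the
  assignment. What remains is a sum weighted by \<open>g\<close> with a fixed order of places, in
  which the letters above \<open>n\<close> are constants.\<close>

lemma universal_annihilator_imp_strong_identity:
  assumes "g \<in> grp_alg n" "g \<noteq> (\<lambda>_. 0)" "universal_annihilator n g"
  shows "strong_identity smul n g"
  unfolding strong_identity_def
proof (intro conjI allI impI ballI assms)
  fix m and a b :: "(nat \<Rightarrow> nat) \<Rightarrow> 'f"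
  assume mn: "n \<le> m"
  let ?P = "\<lambda>k. {\<tau>. \<tau> permutes {1..k::nat}}"
  have sub: "?P n \<subseteq> ?P m" using mn permutes_subset[of _ "{1..n}" "{1..m}"] by auto
  have key: "(\<Sum>\<sigma>\<in>?P m. smul (g \<sigma>) (prod_list (map (z \<circ> \<sigma> \<circ> \<pi>) [1..<Suc m]))) = 0"
    if "\<pi> permutes {1..m}" for \<pi> z
  proof -
    \<comment> \<open>Letters up to \<open>n\<close> stay variables; the others are constants
      already evaluated by \<open>z\<close>.\<close>
    let ?v = "map (\<lambda>k. if k \<in> {1..n} then Inl k else Inr (z k)) (map \<pi> [1..<Suc m])"
    have "map projl (filter isl ?v) = filter (\<lambda>k. k \<in> {1..n}) (map \<pi> [1..<Suc m])"
    proof -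
      have "map projl (filter isl (map (\<lambda>k. if k \<in> {1..n} then Inl k else Inr (z k)) xs))
          = filter (\<lambda>k. k \<in> {1..n}) xs" for xs
        by (induction xs) auto
      then show ?thesis by blast
    qed
    moreover have "set (map \<pi> [1..<Suc m]) = {1..m}"
      using permutes_image[OF that] by (simp add: atLeastLessThanSuc_atLeastAtMost)
    moreover have "distinct (map \<pi> [1..<Suc m])"
      using permutes_inj_on[OF that] by (simp add: distinct_map)
    ultimately have "map projl (filter isl ?v) \<in> permutations_of_set {1..n}"
      using mn by (auto simp: permutations_of_set_def)
    then have "(\<Sum>\<sigma>\<in>?P n. smul (g \<sigma>) (prod_list (map (case_sum (z \<circ> \<sigma>) (\<lambda>b. b)) ?v))) = 0"
      using assms(3) unfolding universal_annihilator_def by blast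
    moreover have "(\<Sum>\<sigma>\<in>?P n. smul (g \<sigma>) (prod_list (map (case_sum (z \<circ> \<sigma>) (\<lambda>b. b)) ?v)))
        = (\<Sum>\<sigma>\<in>?P n. smul (g \<sigma>) (prod_list (map (z \<circ> \<sigma> \<circ> \<pi>) [1..<Suc m])))"
    proof (rule sum.cong[OF refl])
      fix \<sigma> assume "\<sigma> \<in> ?P n"
      then have "map (case_sum (z \<circ> \<sigma>) (\<lambda>b. b)) ?v = map (z \<circ> \<sigma> \<circ> \<pi>) [1..<Suc m]"
        using permutes_not_in[of \<sigma> "{1..n}"] by auto
      then show "smul (g \<sigma>) (prod_list (map (case_sum (z \<circ> \<sigma>) (\<lambda>b. b)) ?v))
          = smul (g \<sigma>) (prod_list (map (z \<circ> \<sigma> \<circ> \<pi>) [1..<Suc m]))" by (simp only:)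
    qed
    ultimately have "(\<Sum>\<sigma>\<in>?P n. smul (g \<sigma>) (prod_list (map (z \<circ> \<sigma> \<circ> \<pi>) [1..<Suc m]))) = 0"
      by (simp only:)
    moreover have "(\<Sum>\<sigma>\<in>?P m. smul (g \<sigma>) (prod_list (map (z \<circ> \<sigma> \<circ> \<pi>) [1..<Suc m])))
        = (\<Sum>\<sigma>\<in>?P n. smul (g \<sigma>) (prod_list (map (z \<circ> \<sigma> \<circ> \<pi>) [1..<Suc m])))"
      using sub assms(1) by (intro sum.mono_neutral_right) (auto simp: finite_permutations grp_alg_def)
    ultimately show ?thesis by simp
  qed
  have "eval_ga m (ga_mult m (ga_mult m a g) b) z = 0" for z
  proof -
    have "eval_ga m (ga_mult m (ga_mult m a g) b) z
        = (\<Sum>\<sigma>\<in>?P m. \<Sum>\<pi>\<in>?P m. smul (b \<pi>)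
            (smul (ga_mult m a g \<sigma>) (prod_list (map (z \<circ> \<sigma> \<circ> \<pi>) [1..<Suc m]))))"
      unfolding eval_ga_def
      by (subst sum_ga_mult) (simp add: scale_sum_right comp_assoc mult.commute)
    also have "\<dots> = (\<Sum>\<pi>\<in>?P m. smul (b \<pi>)
        (\<Sum>\<sigma>\<in>?P m. smul (ga_mult m a g \<sigma>) (prod_list (map (z \<circ> \<sigma> \<circ> \<pi>) [1..<Suc m]))))"
      by (subst sum.swap) (simp only: scale_sum_right)
    also have "\<dots> = 0"
    proof (rule sum.neutral, rule ballI)
      fix \<pi> assume "\<pi> \<in> ?P m"
      then show "smul (b \<pi>) (\<Sum>\<sigma>\<in>?P m. smul (ga_mult m a g \<sigma>)
          (prod_list (map (z \<circ> \<sigma> \<circ> \<pi>) [1..<Suc m]))) = 0"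
        \<comment> \<open>The left factor is absorbed by applying \<open>key\<close> to the
          assignments \<open>z\<close> composed with permutations.\<close>
        using key[of \<pi> "z \<circ> _"] unfolding sum_ga_mult comp_assoc by simp
    qed
    finally show ?thesis .
  qed
  then show "poly_of_ga m (ga_mult m (ga_mult m a g) b) \<in> Id_alg smul"
    unfolding Id_alg_def using ncpoly_poly_of_ga peval_poly_of_ga by auto
qed

end

section \<open>Capelli polynomials\<close>

lemma upt_split: "k \<in> {1..N} \<Longrightarrow> [1..<Suc N] = [1..<k] @ k # [Suc k..<Suc N]"
  using upt_add_eq_append[of 1 k "Suc N - k"] by (simp add: upt_conv_Cons)

definition capelli :: "nat \<Rightarrow> (nat \<Rightarrow> 'b::ring_1) \<Rightarrow> (nat \<Rightarrow> 'b) \<Rightarrow> 'b" where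
  "capelli N x y = (\<Sum>\<pi> | \<pi> permutes {1..N}.
     of_int (sign \<pi>) * prod_list (map (\<lambda>i. x (\<pi> i) * y i) [1..<Suc N]))"

lemma capelli_cong:
  assumes "\<And>i. i \<in> {1..N} \<Longrightarrow> x i = x' i"
  shows "capelli N x y = capelli N x' y"
  unfolding capelli_def
proof (rule sum.cong[OF refl])
  fix \<pi> assume "\<pi> \<in> {\<pi>. \<pi> permutes {1..N}}"
  then have "x (\<pi> i) = x' (\<pi> i)" if "i \<in> {1..N}" for i
    using that assms permutes_in_image[of \<pi> "{1..N}" i] by auto
  then have "map (\<lambda>i. x (\<pi> i) * y i) [1..<Suc N] = map (\<lambda>i. x' (\<pi> i) * y i) [1..<Suc N]" by auto
  then show "of_int (sign \<pi>) * prod_list (map (\<lambda>i. x (\<pi> i) * y i) [1..<Suc N])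
      = of_int (sign \<pi>) * prod_list (map (\<lambda>i. x' (\<pi> i) * y i) [1..<Suc N])" by (simp only:)
qed

text \<open>Composing with the transposition of \<open>i\<close> and \<open>j\<close> keeps the
  product and changes the sign, so the even permutations cancel against their composites.\<close>

lemma capelli_alternating:
  assumes "i \<in> {1..N}" "j \<in> {1..N}" "i \<noteq> j" "x i = x j"
  shows "capelli N x y = 0"
proof -
  let ?t = "transpose i j"
  let ?E = "{\<pi>. \<pi> permutes {1..N} \<and> sign \<pi> = 1}"
  define T where "T \<pi> = prod_list (map (\<lambda>i. x (\<pi> i) * y i) [1..<Suc N])" for \<pi>
  have t: "?t permutes {1..N}" using assms by (intro permutes_swap_id) auto
  have tt: "?t \<circ> (?t \<circ> \<pi>) = \<pi>" for \<pi> by (simp add: fun_eq_iff)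
  have sgn: "sign (?t \<circ> \<pi>) = - sign \<pi>" if "\<pi> permutes {1..N}" for \<pi>
    using that assms(3) t by (subst sign_compose) (auto simp: permutation_permutes sign_swap_id)
  have split: "{\<pi>. \<pi> permutes {1..N}} = ?E \<union> (\<lambda>\<pi>. ?t \<circ> \<pi>) ` ?E" (is "?L = ?R")
  proof
    show "?R \<subseteq> ?L" using permutes_compose[OF _ t] by auto
    show "?L \<subseteq> ?R"
    proof
      fix \<pi> assume "\<pi> \<in> ?L"
      moreover have "sign \<pi> = 1 \<or> sign \<pi> = -1" by (auto simp: sign_def)
      ultimately have "\<pi> \<in> ?E \<or> ?t \<circ> \<pi> \<in> ?E" using sgn permutes_compose[OF _ t] by auto
      then show "\<pi> \<in> ?R" using tt by (metis (no_types, lifting) UnCI imageI)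
    qed
  qed
  have finE: "finite ?E" by (rule finite_subset[of _ ?L]) (auto simp: finite_permutations)
  have inj: "inj_on (\<lambda>\<pi>. ?t \<circ> \<pi>) ?E" by (metis (no_types, lifting) inj_onI tt)
  have T: "T (?t \<circ> \<pi>) = T \<pi>" for \<pi>
  proof -
    have "x (?t k) = x k" for k using assms(4) by (auto simp: transpose_def)
    then show ?thesis by (simp add: T_def)
  qed
  have "(\<Sum>\<pi>\<in>(\<lambda>\<pi>. ?t \<circ> \<pi>) ` ?E. of_int (sign \<pi>) * T \<pi>) = (\<Sum>\<pi>\<in>?E. of_int (sign (?t \<circ> \<pi>)) * T (?t \<circ> \<pi>))"
    unfolding sum.reindex[OF inj] by (simp only: comp_def[of "\<lambda>\<pi>. of_int (sign \<pi>) * T \<pi>"])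
  also have "\<dots> = (\<Sum>\<pi>\<in>?E. - T \<pi>)"
    by (intro sum.cong refl) (simp only: T sgn mem_Collect_eq, simp)
  finally have "(\<Sum>\<pi>\<in>(\<lambda>\<pi>. ?t \<circ> \<pi>) ` ?E. of_int (sign \<pi>) * T \<pi>) = (\<Sum>\<pi>\<in>?E. - T \<pi>)" .
  moreover have "?E \<inter> (\<lambda>\<pi>. ?t \<circ> \<pi>) ` ?E = {}" using sgn by auto
  ultimately show ?thesis
    unfolding capelli_def T_def[symmetric] split using finE
    by (subst sum.union_disjoint) (auto simp: sum_negf)
qed

text \<open>Each term contains argument \<open>k\<close> exactly once, at place
  \<open>inv \<pi> k\<close>. The two-sided coefficients express linearity in this argument.\<close>

lemma capelli_linear:
  assumes "k \<in> {1..N}"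
  shows "\<exists>L R. \<forall>a. capelli N (x(k := a)) y = (\<Sum>\<pi> | \<pi> permutes {1..N}. L \<pi> * a * R \<pi>)"
proof -
  let ?u = "\<lambda>a \<pi> i. (x(k := a)) (\<pi> i) * y i"
  \<comment> \<open>The value \<open>0\<close> at \<open>k\<close> is a placeholder: argument
    \<open>k\<close> does not occur to the left or right of place
    \<open>inv \<pi> k\<close>.\<close>
  let ?L = "\<lambda>\<pi>. of_int (sign \<pi>) * prod_list (map (?u 0 \<pi>) [1..<inv \<pi> k])"
  let ?R = "\<lambda>\<pi>. y (inv \<pi> k) * prod_list (map (?u 0 \<pi>) [Suc (inv \<pi> k)..<Suc N])"
  have "of_int (sign \<pi>) * prod_list (map (?u a \<pi>) [1..<Suc N]) = ?L \<pi> * a * ?R \<pi>"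
    if "\<pi> permutes {1..N}" for \<pi> a
  proof -
    let ?j = "inv \<pi> k"
    have j: "?j \<in> {1..N}" "\<pi> ?j = k"
      using that assms permutes_in_image[OF permutes_inv[OF that]] permutes_inverses(1)[OF that] by auto
    have *: "map (?u a \<pi>) js = map (?u 0 \<pi>) js" if "?j \<notin> set js" for js
      using that permutes_inverses(2)[OF \<open>\<pi> permutes {1..N}\<close>] by auto
    have eq: "map (?u a \<pi>) [1..<?j] = map (?u 0 \<pi>) [1..<?j]"
      "map (?u a \<pi>) [Suc ?j..<Suc N] = map (?u 0 \<pi>) [Suc ?j..<Suc N]"
      by (rule *, simp)+
    show ?thesis
      by (simp only: upt_split[OF j(1)] map_append list.map eq j(2) fun_upd_same
          prod_list.append prod_list.Cons mult.assoc)
  qed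
  then have "capelli N (x(k := a)) y = (\<Sum>\<pi> | \<pi> permutes {1..N}. ?L \<pi> * a * ?R \<pi>)" for a
    unfolding capelli_def by (intro sum.cong) auto
  then show ?thesis by (intro exI[of _ ?L] exI[of _ ?R] allI)
qed

lemma lex_first_difference:
  fixes f h :: "nat \<Rightarrow> nat"
  assumes "k \<in> {1..N}" "\<And>i. i < k \<Longrightarrow> f i = h i" "f k < h k"
  shows "(map f [1..<Suc N], map h [1..<Suc N]) \<in> lex less_than"
proof -
  have "map f [1..<k] = map h [1..<k]" using assms(2) by simp
  moreover have "(f k # map f [Suc k..<Suc N], h k # map h [Suc k..<Suc N]) \<in> lex less_than"
    using assms(3) by simp
  ultimately show ?thesis
    unfolding upt_split[OF assms(1)] map_append list.map by (metis lex_append_leftI)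
qed

text \<open>The least moved point cannot go below itself, since each smaller point is already its
  own image.\<close>

lemma permutation_first_moved:
  fixes n :: nat
  assumes "\<tau> permutes {1..n}" "\<tau> \<noteq> id"
  obtains k where "k \<in> {1..n}" "k < \<tau> k" "\<And>j. j < k \<Longrightarrow> \<tau> j = j"
proof -
  let ?k = "LEAST k. \<tau> k \<noteq> k"
  have "\<exists>k. \<tau> k \<noteq> k" using assms(2) by (auto simp: fun_eq_iff)
  then have k: "\<tau> ?k \<noteq> ?k" by (rule LeastI_ex)
  have less: "\<tau> j = j" if "j < ?k" for j using not_less_Least[OF that] by simp
  have "\<not> \<tau> ?k < ?k"
  proof
    assume "\<tau> ?k < ?k"
    then have "\<tau> (\<tau> ?k) = \<tau> ?k" by (rule less)
    then show False using k permutes_inj[OF assms(1)] by (auto dest: injD)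
  qed
  moreover have "?k \<in> {1..n}" using k permutes_not_in[OF assms(1)] by blast
  moreover have "?k < \<tau> ?k" using k calculation(1) by linarith
  ultimately show thesis using less that by blast
qed

text \<open>A geometric sum with ratio at least two stays below the next power. This count of short
  words gives the term \<open>r ^ d'\<close> of the bound.\<close>

lemma card_short_words_le:
  assumes "finite A" "2 \<le> card A"
  shows "card {w. set w \<subseteq> A \<and> length w < n} \<le> card A ^ n"
proof (cases n)
  case (Suc m)
  have "(\<Sum>i\<le>m. card A ^ i) < card A ^ Suc m" for m
  proof (induction m)
    case (Suc m)
    then have "(\<Sum>i\<le>Suc m. card A ^ i) < 2 * card A ^ Suc m" by simp
    also have "\<dots> \<le> card A ^ Suc (Suc m)" using assms(2) by simp
    finally show ?case .
  qed (use assms in simp)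
  then show ?thesis using card_lists_length_le[OF assms(1), of m] Suc
    by (simp add: less_Suc_eq_le less_imp_le)
qed simp

section \<open>Capelli values at words in the generators\<close>

context assoc_algebra
begin

text \<open>In each term of the Capelli sum the factors \<open>q\<close> are the variables for
  \<open>g\<close> and everything else is constant, so the terms are annihilated one by one.
  \<open>e\<close> selects the arguments that take part.\<close>

lemma capelli_universal_annihilator:
  assumes ann: "universal_annihilator n g"
    and e: "inj_on e {1..n}" "e ` {1..n} \<subseteq> {1..N}"
  shows "(\<Sum>\<tau> | \<tau> permutes {1..n}. smul (g \<tau>) (capelli N (\<lambda>i. if i \<in> e ` {1..n}
      then p i * q (\<tau> (inv_into {1..n} e i)) else x i) y)) = 0"
proof -
  let ?I = "e ` {1..n}" and ?e' = "inv_into {1..n} e"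
  let ?X = "\<lambda>\<tau> i. if i \<in> ?I then p i * q (\<tau> (?e' i)) else x i"
  have zero: "(\<Sum>\<tau> | \<tau> permutes {1..n}. smul (g \<tau>)
      (prod_list (map (\<lambda>i. ?X \<tau> (\<pi> i) * y i) [1..<Suc N]))) = 0" if \<pi>: "\<pi> permutes {1..N}" for \<pi>
  proof -
    let ?h = "\<lambda>i. (if \<pi> i \<in> ?I then [Inr (p (\<pi> i)), Inl (?e' (\<pi> i))] else [Inr (x (\<pi> i))]) @ [Inr (y i)]"
    let ?v = "concat (map ?h [1..<Suc N])"
    have left: "map projl (filter isl (concat (map ?h is))) = map ?e' (filter (\<lambda>k. k \<in> ?I) (map \<pi> is))" for "is"
      by (induction "is") auto
    have "map ?e' (filter (\<lambda>k. k \<in> ?I) (map \<pi> [1..<Suc N])) \<in> permutations_of_set {1..n}"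
    proof -
      have "set (map \<pi> [1..<Suc N]) = {1..N}"
        using permutes_image[OF \<pi>] by (simp add: atLeastLessThanSuc_atLeastAtMost)
      then have I: "set (filter (\<lambda>k. k \<in> ?I) (map \<pi> [1..<Suc N])) = ?I" using e(2) by auto
      have "distinct (filter (\<lambda>k. k \<in> ?I) (map \<pi> [1..<Suc N]))"
        using permutes_inj_on[OF \<pi>] by (simp add: distinct_map)
      then have dist: "distinct (map ?e' (filter (\<lambda>k. k \<in> ?I) (map \<pi> [1..<Suc N])))"
        unfolding distinct_map I using inj_on_inv_into[of ?I e "{1..n}"] by blast
      have "?e' ` ?I = {1..n}" using e(1) by (simp add: inv_into_image_cancel)
      then have "set (map ?e' (filter (\<lambda>k. k \<in> ?I) (map \<pi> [1..<Suc N]))) = {1..n}"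
        unfolding set_map[of ?e'] I .
      then show ?thesis using dist by (rule permutations_of_setI)
    qed
    then have "map projl (filter isl ?v) \<in> permutations_of_set {1..n}" unfolding left .
    then have "(\<Sum>\<tau> | \<tau> permutes {1..n}. smul (g \<tau>) (prod_list (map (case_sum (q \<circ> \<tau>) (\<lambda>b. b)) ?v))) = 0"
      using ann unfolding universal_annihilator_def by blast
    moreover have "prod_list (map (case_sum (q \<circ> \<tau>) (\<lambda>b. b)) (concat (map ?h is)))
        = prod_list (map (\<lambda>i. ?X \<tau> (\<pi> i) * y i) is)" for \<tau> "is"
      by (induction "is") (auto simp: mult.assoc)
    ultimately show ?thesis by (simp only:)
  qed
  have "(\<Sum>\<tau> | \<tau> permutes {1..n}. smul (g \<tau>) (capelli N (?X \<tau>) y))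
      = (\<Sum>\<pi> | \<pi> permutes {1..N}. of_int (sign \<pi>) * (\<Sum>\<tau> | \<tau> permutes {1..n}. smul (g \<tau>)
          (prod_list (map (\<lambda>i. ?X \<tau> (\<pi> i) * y i) [1..<Suc N]))))"
    unfolding capelli_def scale_sum_right sum_distrib_left
    by (subst sum.swap) (simp only: smul_mult_right)
  also have "\<dots> = 0" using zero by simp
  finally show ?thesis .
qed

text \<open>Long words are split as \<open>p i @ q i\<close> with \<open>length (q i)\<close> strictly decreasing in \<open>i\<close>.
  Then every nontrivial permutation of the \<open>q i\<close> makes the sequence of lengths
  lexicographically smaller. When there are fewer than \<open>n\<close> long words left, two of the short
  ones coincide.\<close>

lemma capelli_words:
  fixes gen :: "'i \<Rightarrow> 'b"
  assumes ann: "universal_annihilator n g" and gid: "g id \<noteq> 0"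
    and A: "finite A" and N: "card {w. set w \<subseteq> A \<and> length w < n} + n \<le> N"
    and W: "\<And>i. i \<in> {1..N} \<Longrightarrow> set (W i) \<subseteq> A"
  shows "capelli N (\<lambda>i. prod_list (map gen (W i))) y = 0"
proof -
  let ?ev = "\<lambda>W i. prod_list (map gen (W i))"
  let ?r = "inv_image (lex less_than) (\<lambda>W. map (\<lambda>i. length (W i)) [1..<Suc N])"
  have "wf ?r" by (intro wf_inv_image wf_lex wf_less_than)
  then show ?thesis using W
  proof (induction W rule: wf_induct_rule)
    case (less W)
    let ?I = "{i \<in> {1..N}. n \<le> length (W i)}"
    show ?case
    proof (cases "card ?I < n")
      case True
      \<comment> \<open>With fewer than \<open>n\<close> long words, more than \<open>N - n\<close>
        arguments are short. This exceeds the number of short words, so two arguments agree.\<close>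
      let ?J = "{1..N} - ?I"
      have "card ?J = N - card ?I" by (subst card_Diff_subset) auto
      then have "card {w. set w \<subseteq> A \<and> length w < n} < card ?J" using True N by linarith
      moreover have "W ` ?J \<subseteq> {w. set w \<subseteq> A \<and> length w < n}"
      proof (rule image_subsetI)
        fix i assume "i \<in> ?J"
        then show "W i \<in> {w. set w \<subseteq> A \<and> length w < n}" using less.prems[of i] by auto
      qed
      moreover have "finite {w. set w \<subseteq> A \<and> length w < n}"
        by (rule finite_subset[OF _ finite_lists_length_le[OF A, of n]]) auto
      ultimately have "\<not> inj_on W ?J" using card_inj_on_le not_le by blast
      then obtain i j where "i \<in> ?J" "j \<in> ?J" "i \<noteq> j" "W i = W j" unfolding inj_on_def by blast
      then show ?thesis by (intro capelli_alternating[of i N j]) auto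
    next
      case False
      then obtain I where I: "I \<subseteq> ?I" "card I = n" by (meson obtain_subset_with_card_n not_le)
      have "finite I" by (rule finite_subset[OF I(1)]) simp
      then obtain h where h: "bij_betw h {..<card I} I" "strict_mono_on {..<card I} h"
        by (rule ex_bij_betw_strict_mono_card)
      \<comment> \<open>\<open>h\<close> counts from 0, whereas the permutations act on
        \<open>{1..n}\<close>.\<close>
      define e where "e j = h (j - 1)" for j
      have bij_e: "bij_betw e {1..n} I"
      proof -
        have "bij_betw (\<lambda>j. j - 1) {1..n} {..<n}"
          by (rule bij_betw_byWitness[where f' = Suc]) auto
        then have "bij_betw (h \<circ> (\<lambda>j. j - 1)) {1..n} I"
          by (rule bij_betw_trans[OF _ h(1)[unfolded I(2)]])
        moreover have "e = h \<circ> (\<lambda>j. j - 1)" by (auto simp: e_def)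
        ultimately show ?thesis by simp
      qed
      have e: "inj_on e {1..n}" "e ` {1..n} = I" using bij_e by (auto simp: bij_betw_def)
      have mono_e: "e j < e k" if "j \<in> {1..n}" "k \<in> {1..n}" "j < k" for j k
        using that strict_mono_onD[OF h(2), of "j - 1" "k - 1"] by (auto simp: e_def I(2))
      let ?e' = "inv_into {1..n} e"
      have e': "?e' i \<in> {1..n}" "e (?e' i) = i" if "i \<in> I" for i
        using that inv_into_into[of i e "{1..n}"] f_inv_into_f[of i e "{1..n}"] unfolding e(2) by blast+
      have e'e: "?e' (e j) = j" if "j \<in> {1..n}" for j using that e(1) by simp
      have long: "n \<le> length (W i)" "i \<in> {1..N}" if "i \<in> I" for i using that I(1) by auto
      \<comment> \<open>The suffix of the \<open>j\<close>-th chosen word gets length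
        \<open>Suc n - j\<close>. These lengths run strictly downwards from \<open>n\<close> to 1,
        so they fit into words of length at least \<open>n\<close>.\<close>
      let ?c = "\<lambda>i. length (W i) - (Suc n - ?e' i)"
      define p where "p i = take (?c i) (W i)" for i
      define q where "q j = drop (?c (e j)) (W (e j))" for j
      have pq: "p i @ q (?e' i) = W i" if "i \<in> I" for i using e'[OF that] by (simp add: p_def q_def)
      have len_q: "length (q j) = Suc n - j" if "j \<in> {1..n}" for j
        using that long(1)[of "e j"] e(2) e'e[OF that] by (auto simp: q_def)
      define V where "V \<tau> i = (if i \<in> I then p i @ q (\<tau> (?e' i)) else W i)" for \<tau> i
      have V_id: "V id = W" using pq by (auto simp: V_def)
      \<comment> \<open>At the first moved index \<open>k\<close> a shorter suffix arrives because
        \<open>k < \<tau> k\<close>, while all earlier words are unchanged; the length sequence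
        drops and induction applies.\<close>
      have smaller: "capelli N (?ev (V \<tau>)) y = 0" if \<tau>: "\<tau> permutes {1..n}" "\<tau> \<noteq> id" for \<tau>
      proof (rule less.IH)
        obtain k where k: "k \<in> {1..n}" "k < \<tau> k" "\<And>j. j < k \<Longrightarrow> \<tau> j = j"
          using permutation_first_moved[OF \<tau>] by blast
        have ek: "e k \<in> I" using k(1) e(2) by blast
        have "\<tau> k \<in> {1..n}" using permutes_in_image[OF \<tau>(1)] k(1) by blast
        have "length (V \<tau> (e k)) < length (W (e k))"
        proof -
          have "length (V \<tau> (e k)) = length (p (e k)) + length (q (\<tau> k))"
            using ek e'e[OF k(1)] by (simp add: V_def)
          also have "\<dots> < length (p (e k)) + length (q k)"
            using k(1,2) len_q[OF k(1)] len_q[OF \<open>\<tau> k \<in> {1..n}\<close>] by auto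
          also have "\<dots> = length (W (e k))"
            using arg_cong[OF pq[OF ek], of length] e'e[OF k(1)] by simp
          finally show ?thesis .
        qed
        moreover have "V \<tau> i = W i" if "i < e k" for i
        proof (cases "i \<in> I")
          case True
          have "?e' i < k"
          proof (rule ccontr)
            assume "\<not> ?e' i < k"
            then have "e k \<le> i"
              using mono_e[OF k(1) e'(1)[OF True]] e'(2)[OF True] by (cases "k = ?e' i") auto
            with that show False by simp
          qed
          then show ?thesis using True pq k(3) by (simp add: V_def)
        qed (simp add: V_def)
        ultimately show "(V \<tau>, W) \<in> ?r"
          using long(2)[OF ek] unfolding in_inv_image by (intro lex_first_difference) auto
        fix i assume i: "i \<in> {1..N}"
        show "set (V \<tau> i) \<subseteq> A"
        proof (cases "i \<in> I")
          case True
          let ?j = "e (\<tau> (?e' i))"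
          have "?j \<in> I" using e'(1)[OF True] permutes_in_image[OF \<tau>(1)] e(2) by blast
          then have "set (W ?j) \<subseteq> A" using long less.prems by blast
          moreover have "set (W i) \<subseteq> A" using i less.prems by blast
          ultimately have "set (p i) \<subseteq> A" "set (q (\<tau> (?e' i))) \<subseteq> A"
            unfolding p_def q_def by (meson set_take_subset set_drop_subset subset_trans)+
          then show ?thesis using True by (simp add: V_def)
        qed (use i less.prems in \<open>simp add: V_def\<close>)
      qed
      have "?ev (V \<tau>) = (\<lambda>i. if i \<in> e ` {1..n} then prod_list (map gen (p i))
          * prod_list (map gen (q (\<tau> (?e' i)))) else ?ev W i)" for \<tau>
        unfolding e(2) V_def by (rule ext) simp
      moreover have "e ` {1..n} \<subseteq> {1..N}" using e(2) long(2) by blast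
      ultimately have "0 = (\<Sum>\<tau> | \<tau> permutes {1..n}. smul (g \<tau>) (capelli N (?ev (V \<tau>)) y))"
        using capelli_universal_annihilator[OF ann e(1), of N "\<lambda>i. prod_list (map gen (p i))"
            "\<lambda>j. prod_list (map gen (q j))" "?ev W" y] by (simp only:)
      \<comment> \<open>Only \<open>id\<close> survives; it gives back \<open>W\<close> with the
        nonzero coefficient \<open>g id\<close>.\<close>
      also have "\<dots> = (\<Sum>\<tau>\<in>{id}. smul (g \<tau>) (capelli N (?ev (V \<tau>)) y))"
        using smaller by (intro sum.mono_neutral_right) (auto simp: finite_permutations permutes_id)
      finally show ?thesis using gid V_id by simp
    qed
  qed
qed

text \<open>Induction on the number \<open>k\<close> of leading arguments that are still arbitrary:
  linearity replaces argument \<open>Suc k\<close> by words in the generators, and once all are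
  words \<open>capelli_words\<close> applies.\<close>

lemma capelli_identity_affine:
  assumes "universal_annihilator n g" "g id \<noteq> 0"
    and gen: "affine_gen smul r gen" and N: "card {w. set w \<subseteq> {1..r} \<and> length w < n} + n \<le> N"
  shows "satisfies_capelli N TYPE('b)"
proof -
  let ?word = "\<lambda>w. prod_list (map gen w)"
  have "capelli N x y = 0"
    if "k \<le> N" "\<And>i. i \<in> {k<..N} \<Longrightarrow> \<exists>w. set w \<subseteq> {1..r} \<and> x i = ?word w" for k x y
    using that
  proof (induction k arbitrary: x)
    case 0
    then have "\<forall>i. \<exists>w. i \<in> {1..N} \<longrightarrow> set w \<subseteq> {1..r} \<and> x i = ?word w" by auto
    then obtain W where W: "\<And>i. i \<in> {1..N} \<Longrightarrow> set (W i) \<subseteq> {1..r} \<and> x i = ?word (W i)"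
      by metis
    then have "capelli N x y = capelli N (\<lambda>i. ?word (W i)) y" by (intro capelli_cong) simp
    also have "\<dots> = 0" using W by (intro capelli_words[OF assms(1,2) _ N]) auto
    finally show ?case .
  next
    case (Suc k)
    obtain P c where P: "finite P" "\<forall>w\<in>P. set w \<subseteq> {1..r}"
      "x (Suc k) = (\<Sum>w\<in>P. smul (c w) (?word w))"
      using gen[unfolded affine_gen_def, rule_format, of "x (Suc k)"] by (elim exE conjE)
    have "Suc k \<in> {1..N}" using Suc.prems(1) by auto
    then obtain L R where LR: "\<And>a. capelli N (x(Suc k := a)) y = (\<Sum>\<pi> | \<pi> permutes {1..N}. L \<pi> * a * R \<pi>)"
      using capelli_linear[of "Suc k" N x y] by blast
    have "capelli N x y = (\<Sum>\<pi> | \<pi> permutes {1..N}. L \<pi> * (\<Sum>w\<in>P. smul (c w) (?word w)) * R \<pi>)"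
      using LR[of "x (Suc k)"] unfolding fun_upd_triv unfolding P(3) .
    also have "\<dots> = (\<Sum>w\<in>P. smul (c w) (capelli N (x(Suc k := ?word w)) y))"
      unfolding LR sum_distrib_left sum_distrib_right scale_sum_right
      by (subst sum.swap) (simp add: smul_mult_left[symmetric] smul_mult_right[symmetric])
    also have "\<dots> = 0"
    proof (rule sum.neutral, rule ballI)
      fix w assume "w \<in> P"
      have "capelli N (x(Suc k := ?word w)) y = 0"
      proof (rule Suc.IH)
        fix i assume i: "i \<in> {k<..N}"
        show "\<exists>v. set v \<subseteq> {1..r} \<and> (x(Suc k := ?word w)) i = ?word v"
        proof (cases "i = Suc k")
          case True
          then show ?thesis using P(2) \<open>w \<in> P\<close> by (intro exI[of _ w]) auto
        next
          case False
          then show ?thesis using Suc.prems(2)[of i] i by auto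
        qed
      qed (use Suc.prems(1) in simp)
      then show "smul (c w) (capelli N (x(Suc k := ?word w)) y) = 0" by simp
    qed
    finally show ?case .
  qed
  from this[of N] show ?thesis unfolding satisfies_capelli_def capelli_def by simp
qed

text \<open>Translation by a permutation in the support of \<open>g\<close> makes the coefficient of
  \<open>id\<close> nonzero, as \<open>capelli_words\<close> requires. It amounts to evaluating at
  \<open>x \<circ> inv \<sigma>\<close>.\<close>

lemma universal_annihilator_shift:
  assumes "universal_annihilator n g" "\<sigma> permutes {1..n}"
  shows "universal_annihilator n (\<lambda>\<tau>. g (\<sigma> \<circ> \<tau>))"
  unfolding universal_annihilator_def
proof (intro allI impI)
  fix v :: "(nat + 'b) list" and x
  assume v: "map projl (filter isl v) \<in> permutations_of_set {1..n}"
  let ?M = "\<lambda>x. prod_list (map (case_sum x (\<lambda>b. b)) v)"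
  have "(\<Sum>\<tau> | \<tau> permutes {1..n}. smul (g (\<sigma> \<circ> \<tau>)) (?M (x \<circ> \<tau>)))
      = (\<Sum>\<rho> | \<rho> permutes {1..n}. smul (g \<rho>) (?M ((x \<circ> inv \<sigma>) \<circ> \<rho>)))"
    using assms(2) permutes_inv[OF assms(2)]
    by (intro sum.reindex_bij_witness[of _ "\<lambda>\<rho>. inv \<sigma> \<circ> \<rho>" "\<lambda>\<tau>. \<sigma> \<circ> \<tau>"])
      (auto simp: permutes_compose comp_assoc[symmetric] permutes_inv_o comp_assoc[of x])
  also have "\<dots> = 0" using assms(1) v unfolding universal_annihilator_def by blast
  finally show "(\<Sum>\<tau> | \<tau> permutes {1..n}. smul (g (\<sigma> \<circ> \<tau>)) (?M (x \<circ> \<tau>))) = 0" .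
qed

section \<open>Algebras with at most one generator\<close>

lemma commutative_if_one_generator:
  assumes "affine_gen smul r gen" "r \<le> 1"
  shows "x * y = y * (x :: 'b)"
proof -
  let ?word = "\<lambda>w. prod_list (map gen w)"
  have word: "\<exists>k. ?word w = gen 1 ^ k" if "set w \<subseteq> {1..r}" for w
    using that
  proof (induction w)
    case Nil
    show ?case by (intro exI[of _ 0]) simp
  next
    case (Cons a w)
    then obtain k where "?word w = gen 1 ^ k" by auto
    moreover have "a = 1" using Cons.prems assms(2) by auto
    ultimately show ?case by (intro exI[of _ "Suc k"]) simp
  qed
  have comm_word: "?word w * ?word v = ?word v * ?word w" if "set w \<subseteq> {1..r}" "set v \<subseteq> {1..r}" for v w
    using word[OF that(1)] word[OF that(2)] by (metis add.commute power_add)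
  have half: "a * ?word v = ?word v * a" if "set v \<subseteq> {1..r}" for a v
  proof -
    obtain P c where P: "\<forall>w\<in>P. set w \<subseteq> {1..r}" "a = (\<Sum>w\<in>P. smul (c w) (?word w))"
      using assms(1) unfolding affine_gen_def by blast
    show ?thesis unfolding P(2) sum_distrib_left sum_distrib_right
      using P(1) comm_word that by (intro sum.cong refl) (simp flip: smul_mult_left smul_mult_right)
  qed
  obtain P c where P: "\<forall>w\<in>P. set w \<subseteq> {1..r}" "y = (\<Sum>w\<in>P. smul (c w) (?word w))"
    using assms(1) unfolding affine_gen_def by blast
  show ?thesis unfolding P(2) sum_distrib_left sum_distrib_right
  proof (rule sum.cong[OF refl])
    fix w assume "w \<in> P"
    then have "x * ?word w = ?word w * x" using P(1) half by blast
    then show "x * smul (c w) (?word w) = smul (c w) (?word w) * x"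
      by (simp flip: smul_mult_left smul_mult_right)
  qed
qed

text \<open>Only the two permutations of \<open>{1..2}\<close> enter the sum, so the function stands
  for \<open>id\<close> minus the transposition, that is, for x_1 x_2 - x_2 x_1.\<close>

lemma universal_annihilator_commutative:
  assumes comm: "\<And>x y :: 'b. x * y = y * x"
  shows "universal_annihilator 2 (\<lambda>\<tau>. if \<tau> = id then 1 else -1)"
  unfolding universal_annihilator_def
proof (intro allI impI)
  fix v :: "(nat + 'b) list" and x
  let ?u = "map projl (filter isl v)"
  have two: "{1..2::nat} = {1, 2}" by auto
  assume "?u \<in> permutations_of_set {1..2}"
  then have u: "?u = [1, 2] \<or> ?u = [2, 1]" unfolding two by (simp add: permutations_of_set_doubleton)
  obtain y ys where ys: "length ys = length (filter isl v)"
    "\<And>x. prod_list (map (case_sum x (\<lambda>b. b)) v) = y * prod_list (map2 (\<lambda>a y. x a * y) ?u ys)"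
    using monomial_with_constants[of v] by blast
  have "length ys = 2" using ys(1) u by (metis length_map length_Cons list.size(3) numeral_2_eq_2)
  then obtain c d where cd: "ys = [c, d]" by (auto simp: numeral_2_eq_2 length_Suc_conv)
  have swap: "a * c * (b * d) = b * c * (a * d)" for a b
    by (metis comm mult.assoc)
  have "{\<tau>. \<tau> permutes {1..2::nat}} = {id, transpose 1 2}"
    unfolding two by (auto simp: permutes_doubleton_iff)
  moreover have "transpose 1 (2::nat) \<noteq> id" by (metis id_apply one_eq_numeral_iff semiring_norm(85) transpose_apply_first)
  ultimately show "(\<Sum>\<tau> | \<tau> permutes {1..2}. smul (if \<tau> = id then 1 else -1)
      (prod_list (map (case_sum (x \<circ> \<tau>) (\<lambda>b. b)) v))) = 0"
    unfolding ys(2) cd using u swap[of "x 1" "x 2"] by auto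
qed

end

section \<open>The degree bound\<close>

text \<open>One term of the exponential series; at \<open>x = n\<close> it gives n! >=
  (n/e)^n.\<close>

lemma power_le_fact_mult_exp:
  fixes x :: real
  assumes "0 \<le> x"
  shows "x ^ n \<le> fact n * exp x"
proof -
  have "(\<Sum>k\<in>{n}. x ^ k /\<^sub>R fact k) \<le> exp x"
    unfolding exp_def using assms summable_exp_generic[of x] by (intro sum_le_suminf) auto
  then show ?thesis by (simp add: field_simps)
qed

text \<open>With D = d - 1, the choice of \<open>n\<close> gives n >= (e D^4)^2 = e^2 D^8, hence n!
  >= (n/e)^n >= (e D^8)^n > D^(8 n). The spare factor e makes the inequality strict.\<close>

lemma power_less_fact:
  fixes d :: nat
  assumes "2 \<le> d" and n: "n = (nat \<lceil>exp 1 * (real d - 1) ^ 4\<rceil>) ^ 2"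
  shows "(d - 1) ^ (8 * n) < fact n"
proof -
  define D where "D = real d - 1"
  have D: "1 \<le> D" "real (d - 1) = D" using assms(1) by (auto simp: D_def)
  have "exp 1 * D ^ 4 \<le> real (nat \<lceil>exp 1 * D ^ 4\<rceil>)" by (rule real_nat_ceiling_ge)
  then have "(exp 1 * D ^ 4) ^ 2 \<le> real n"
    unfolding n of_nat_power D_def[symmetric] using D by (intro power_mono) auto
  then have le: "exp 1 * (exp 1 * D ^ 8) \<le> real n" by (simp add: power2_eq_square algebra_simps flip: power_add)
  have pos: "0 < n"
  proof -
    have "0 < exp 1 * (exp 1 * D ^ 8)" using D by simp
    with le show ?thesis by linarith
  qed
  have "exp (real n) * (exp 1 * D ^ 8) ^ n = (exp 1 * (exp 1 * D ^ 8)) ^ n"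
    by (simp add: power_mult_distrib exp_of_nat_mult[of n 1, simplified])
  also have "\<dots> \<le> real n ^ n" using le D by (intro power_mono) auto
  also have "\<dots> \<le> exp (real n) * fact n" using power_le_fact_mult_exp[of "real n" n] by (simp add: mult.commute)
  finally have fact: "(exp 1 * D ^ 8) ^ n \<le> fact n" by simp
  have "D ^ 8 < exp 1 * D ^ 8" using D by simp
  then have "(D ^ 8) ^ n < (exp 1 * D ^ 8) ^ n" using D pos by (intro power_strict_mono) auto
  with fact have "real ((d - 1) ^ (8 * n)) < real (fact n)" using D(2) by (simp add: power_mult)
  then show ?thesis by (simp only: of_nat_less_iff)
qed

lemma degree_bound_ge_4:
  fixes d :: nat
  assumes "2 \<le> d"
  shows "4 \<le> (nat \<lceil>exp 1 * (real d - 1) ^ 4\<rceil>) ^ 2"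
proof -
  have "1 * 1 < exp 1 * (real d - 1) ^ 4"
    using assms by (intro mult_less_le_imp_less one_le_power) auto
  then have "2 \<le> nat \<lceil>exp 1 * (real d - 1) ^ 4\<rceil>" by linarith
  then have "2 ^ 2 \<le> (nat \<lceil>exp 1 * (real d - 1) ^ 4\<rceil>) ^ 2" by (rule power_mono) simp
  then show ?thesis by simp
qed

theorem theorem3p17:
  fixes smul :: "'f::field_char_0 \<Rightarrow> 'b::ring_1 \<Rightarrow> 'b"
    and d :: nat
  assumes alg: "f_algebra smul"
    and PI: "has_PI_of_degree smul d"
  defines "d' \<equiv> (nat \<lceil>exp 1 * (real d - 1) ^ 4\<rceil>) ^ 2"
  shows "(\<exists>g. strong_identity smul d' g)
       \<and> (\<forall>r gen. affine_gen smul r gen \<longrightarrow> satisfies_capelli (r ^ d' + d') TYPE('b))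
       \<and> (\<forall>r gen. affine_gen smul r gen \<longrightarrow> (\<exists>n. satisfies_capelli n TYPE('b)))"
proof -
  interpret assoc_algebra smul using alg by (simp add: assoc_algebra_iff)
  obtain \<alpha> where \<alpha>: "\<alpha> [0..<d] \<noteq> 0"
    "\<And>z. (\<Sum>v\<in>permutations_of_set {..<d}. smul (\<alpha> v) (prod_list (map z v))) = 0"
    using has_PI_imp_multilinear[OF PI] by blast
  have d: "2 \<le> d" using multilinear_identity_degree_ge_2[OF \<alpha>] .
  then have "(d - 1) ^ (8 * d') < fact d'" by (rule power_less_fact) (simp add: d'_def)
  then obtain g where g: "g \<in> grp_alg d'" "g \<noteq> (\<lambda>_. 0)" "universal_annihilator d' g"
    using universal_annihilator_exists[OF \<alpha>, of d'] d by auto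
  then obtain \<sigma> where \<sigma>: "\<sigma> permutes {1..d'}" "g \<sigma> \<noteq> 0" by (auto simp: grp_alg_def)
  have cap: "satisfies_capelli (r ^ d' + d') TYPE('b)" if gen: "affine_gen smul r gen" for r gen
  proof (cases "2 \<le> r")
    case True
    have "card {w. set w \<subseteq> {1..r} \<and> length w < d'} + d' \<le> r ^ d' + d'"
      using card_short_words_le[of "{1..r}" d'] True by simp
    then show ?thesis
      using capelli_identity_affine[OF universal_annihilator_shift[OF g(3) \<sigma>(1)] _ gen] \<sigma>(2) by simp
  next
    case False
    \<comment> \<open>For \<open>r \<le> 1\<close> the commutator of degree 2 replaces
      \<open>g\<close>. At most two words have length below 2, and 2 + 2 is within the bound because
      \<open>d'\<close> is at least 4.\<close>
    have "{w. set w \<subseteq> {1..r} \<and> length w < 2} = {w. set w \<subseteq> {1..r} \<and> length w \<le> 1}" by auto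
    then have "card {w. set w \<subseteq> {1..r} \<and> length w < 2} \<le> 2"
      using False card_lists_length_le[of "{1..r}" 1] by simp
    then have "card {w. set w \<subseteq> {1..r} \<and> length w < 2} + 2 \<le> r ^ d' + d'"
      using degree_bound_ge_4[OF d] unfolding d'_def by linarith
    then show ?thesis
      using False commutative_if_one_generator[OF gen]
      by (intro capelli_identity_affine[OF universal_annihilator_commutative _ gen]) auto
  qed
  then show ?thesis using universal_annihilator_imp_strong_identity[OF g] by blast
qed

end
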